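(* Let $\epsilon>0$ and let $\gamma:(-\epsilon,\epsilon)\to\mathbb{R}^2$ be a $C^\infty$ curve in the Euclidean plane such that $t=0$ is a $3/2$-cusp. Let $s_g(t)=\int_0^t|\dot\gamma(u)|\,du$ be the arclength parameter, and let $\kappa_g$ be the curvature function (defined for $t\neq 0$ near $0$). Then $\tau=\operatorname{sgn}(t)\sqrt{|s_g|}$ can be taken to be a coordinate of $\gamma$ at $t=0$ (called the half-arclength parameter), and $\sqrt{|s_g|}\,\kappa_g$ is a $C^\infty$-function of $t$ (and of $\tau$) at $t=0$. Moreover, $$\lim_{t\to 0}\sqrt{|s_g|}\,\kappa_g=\frac{\mu_g}{2\sqrt2},$$ where $\mu_g$ is the cuspidal curvature of $\gamma$ at $t=0$. Conversely, for any $C^\infty$-function $f(\tau)$ (defined near $\tau=0$) with $f(0)\neq 0$, there exists a curve $\gamma(\tau)$ in $\mathbb{R}^2$ with a $3/2$-cusp at $\tau=0$ such that $\sqrt{|s_g|}\,\kappa_g=f(\tau)$ and $\tau$ is the half-arclength parameter of $\gamma$.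
   Context: For $\mathbf a,\mathbf b\in\mathbb{R}^2$, $[\mathbf a,\mathbf b]=a_1b_2-a_2b_1$. Dots and superscripts $^{(k)}$ denote derivatives with respect to $t$. A point $t=0$ of a $C^\infty$ curve $\gamma$ is a singular point if $\dot\gamma(0)=0$; a singular point is a $3/2$-cusp if after a suitable coordinate change of the parameter and a local diffeomorphism of $\mathbb{R}^2$ at $\gamma(0)$ the curve becomes $t\mapsto(t^2,t^3)$; equivalently, $\dot\gamma(0)=0$ and $[\ddot\gamma(0),\gamma^{(3)}(0)]\ne0$. The curvature is $\kappa_g(t)=[\dot\gamma(t),\ddot\gamma(t)]/|\dot\gamma(t)|^3$. The (Euclidean) cuspidal curvature at a $3/2$-cusp $t=0$ is $$\mu_g=\frac{[\ddot\gamma(0),\gamma^{(3)}(0)]}{|\ddot\gamma(0)|^{5/2}}.$$ All assertions about smoothness at $t=0$ concern germs at $t=0$, functions being extended across $t=0$. *)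

theory Defs
  imports "HOL-Analysis.Analysis"
begin

text \<open>
  Smoothness is meant for open sets: f is of class \<open>C\<^sup>k\<close> iff it is Frechet differentiable and
  all its directional derivatives are of class \<open>C\<^sup>k\<^sup>-\<^sup>1\<close>.
\<close>

primrec C_k_on :: "nat \<Rightarrow> ('a::euclidean_space \<Rightarrow> 'b::euclidean_space) \<Rightarrow> 'a set \<Rightarrow> bool" where
  "C_k_on 0 f S \<longleftrightarrow> continuous_on S f"
| "C_k_on (Suc k) f S \<longleftrightarrow>
     (\<forall>x\<in>S. f differentiable (at x)) \<and> (\<forall>v. C_k_on k (\<lambda>x. frechet_derivative f (at x) v) S)"

definition smooth_on :: "'a set \<Rightarrow> ('a::euclidean_space \<Rightarrow> 'b::euclidean_space) \<Rightarrow> bool" where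
  "smooth_on S f \<longleftrightarrow> (\<forall>k. C_k_on k f S)"

definition smooth_at :: "('a::euclidean_space \<Rightarrow> 'b::euclidean_space) \<Rightarrow> 'a \<Rightarrow> bool" where
  "smooth_at f x \<longleftrightarrow> (\<exists>S. open S \<and> x \<in> S \<and> smooth_on S f)"

definition diffeomorphism ::
  "'a set \<Rightarrow> 'b set \<Rightarrow> ('a::euclidean_space \<Rightarrow> 'b::euclidean_space) \<Rightarrow> ('b \<Rightarrow> 'a) \<Rightarrow> bool" where
  "diffeomorphism U V f g \<longleftrightarrow>
     open U \<and> open V \<and> homeomorphism U V f g \<and> smooth_on U f \<and> smooth_on V g"

definition local_diffeo_at :: "('a::euclidean_space \<Rightarrow> 'b::euclidean_space) \<Rightarrow> 'a \<Rightarrow> bool" where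
  "local_diffeo_at f x \<longleftrightarrow> (\<exists>U V g. x \<in> U \<and> diffeomorphism U V f g)"

definition bracket :: "real^2 \<Rightarrow> real^2 \<Rightarrow> real" where
  "bracket a b = a$1 * b$2 - a$2 * b$1"

definition nth_deriv :: "nat \<Rightarrow> (real \<Rightarrow> real^2) \<Rightarrow> real \<Rightarrow> real^2" where
  "nth_deriv k = ((\<lambda>g t. vector_derivative g (at t)) ^^ k)"

definition singular_point :: "(real \<Rightarrow> real^2) \<Rightarrow> real \<Rightarrow> bool" where
  "singular_point \<gamma> t0 \<longleftrightarrow> nth_deriv 1 \<gamma> t0 = 0"

text \<open>
  In the next definition \<open>\<phi>\<close> expresses the old parameter through the new one, and \<open>\<Phi>\<close> is the
  change of coordinates of the plane. The condition depends only on the germ of the curve.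
\<close>

definition cusp_3_2 :: "(real \<Rightarrow> real^2) \<Rightarrow> real \<Rightarrow> bool" where
  "cusp_3_2 \<gamma> t0 \<longleftrightarrow> singular_point \<gamma> t0 \<and>
     (\<exists>(\<phi> :: real \<Rightarrow> real) (\<Phi> :: real^2 \<Rightarrow> real^2).
        local_diffeo_at \<phi> 0 \<and> \<phi> 0 = t0 \<and> local_diffeo_at \<Phi> (\<gamma> t0) \<and>
        (\<forall>\<^sub>F u in nhds 0. \<Phi> (\<gamma> (\<phi> u)) = vector [u^2, u^3]))"

definition curvature :: "(real \<Rightarrow> real^2) \<Rightarrow> real \<Rightarrow> real" where
  "curvature \<gamma> t = bracket (nth_deriv 1 \<gamma> t) (nth_deriv 2 \<gamma> t) / norm (nth_deriv 1 \<gamma> t) ^ 3"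

definition cuspidal_curvature :: "(real \<Rightarrow> real^2) \<Rightarrow> real \<Rightarrow> real" where
  "cuspidal_curvature \<gamma> t0 =
     bracket (nth_deriv 2 \<gamma> t0) (nth_deriv 3 \<gamma> t0) / norm (nth_deriv 2 \<gamma> t0) powr (5/2)"

text \<open>The interval integral is oriented, so the arclength is negative for negative \<open>t\<close>.\<close>

definition arclength :: "(real \<Rightarrow> real^2) \<Rightarrow> real \<Rightarrow> real" where
  "arclength \<gamma> t = (LBINT u=ereal 0..ereal t. norm (nth_deriv 1 \<gamma> u))"

definition half_arclength :: "(real \<Rightarrow> real^2) \<Rightarrow> real \<Rightarrow> real" where
  "half_arclength \<gamma> t = sgn t * sqrt \<bar>arclength \<gamma> t\<bar>"

definition normalized_curvature :: "(real \<Rightarrow> real^2) \<Rightarrow> real \<Rightarrow> real" where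
  "normalized_curvature \<gamma> t = sqrt \<bar>arclength \<gamma> t\<bar> * curvature \<gamma> t"

end

theory Submission
  imports Defs
begin

text \<open>
  Everything about a cusp is read off from the smooth quotient \<open>v t = \<gamma>' t / t\<close>, for which
  \<open>bracket (v 0) (v' 0) \<noteq> 0\<close> (\<open>cusp_3_2_velocity\<close>). The arclength is
  \<open>sgn t * t\<^sup>2 * A t\<close>, where \<open>t\<^sup>2 * A t\<close> is the primitive of \<open>t * norm (v t)\<close>; dividing this primitive by \<open>t\<^sup>2\<close>
  keeps it smooth (\<open>smooth_moment\<close>), and \<open>A 0 = norm (v 0) / 2 > 0\<close>. Hence the half-arclength is
  \<open>t * sqrt (A t)\<close>, a local coordinate by the inverse function theorem. From \<open>\<gamma>'' = v + t *\<^sub>R v'\<close> the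
  curvature is \<open>bracket v v' / (\<bar>t\<bar> * norm v ^ 3)\<close>, so the absolute value cancels in the normalized
  curvature \<open>sqrt A * bracket v v' / norm v ^ 3\<close>, which is smooth; its value at \<open>0\<close> is the asserted
  limit (\<open>cusp_local_form\<close>).

  Conversely, a curve with half-arclength parameter has \<open>v = 2 *\<^sub>R (cos \<theta>, sin \<theta>)\<close> and its normalized
  curvature is \<open>\<theta>' / 2\<close>. So \<open>f\<close> determines \<open>\<theta>\<close> and, by another integration, the curve
  (\<open>cusp_with_prescribed_curvature\<close>).

  The definition of a cusp demands coordinate changes that turn the curve into \<open>(u\<^sup>2, u\<^sup>3)\<close>, and
  in the converse these have to be constructed (\<open>cusp_3_2_normal_form\<close>). After a change of the
  parameter the curve is \<open>(u\<^sup>2, u\<^sup>3 * c u)\<close>. Splitting \<open>c\<close> into even and odd parts and writing both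
  through smooth functions of \<open>u\<^sup>2\<close> yields an explicit coordinate change of the plane. That an
  even smooth function is a smooth function of the square is Whitney's theorem (\<open>Whitney_even\<close>). It
  rests on Borel's theorem (\<open>Borel\<close>): after subtracting a function with the right Taylor
  coefficients, the remainder is flat, and composing a flat function with the square root is
  harmless.
\<close>

section \<open>Calculus of smooth maps\<close>

lemma C_k_on_cong_imp:
  assumes "open S" "\<And>x. x \<in> S \<Longrightarrow> f x = g x" "C_k_on k f S"
  shows "C_k_on k g S"
  using assms(2,3)
proof (induction k arbitrary: f g)
  case 0
  have "continuous_on S f = continuous_on S g"
    by (rule continuous_on_cong) (use 0 in auto)
  with 0 show ?case by simp
next
  case (Suc k)
  have fd: "(g has_derivative frechet_derivative f (at x)) (at x)" if x: "x \<in> S" for x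
  proof -
    have "(f has_derivative frechet_derivative f (at x)) (at x)"
      using Suc.prems(2) x by (simp add: frechet_derivative_works[symmetric])
    then show ?thesis
      by (rule has_derivative_transform_within_open[OF _ \<open>open S\<close> x]) (rule Suc.prems(1))
  qed
  have eq: "frechet_derivative f (at x) = frechet_derivative g (at x)" if "x \<in> S" for x
    using fd[OF that] frechet_derivative_at by blast
  have "C_k_on k (\<lambda>x. frechet_derivative g (at x) v) S" for v
  proof (rule Suc.IH)
    show "C_k_on k (\<lambda>x. frechet_derivative f (at x) v) S"
      using Suc.prems(2) by simp
  qed (simp add: eq)
  moreover have "\<forall>x\<in>S. g differentiable (at x)"
    using fd unfolding differentiable_def by blast
  ultimately show ?case by simp
qed

lemma C_k_on_SucI:
  assumes "open S" "\<And>x. x \<in> S \<Longrightarrow> (f has_derivative f' x) (at x)"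
    and "\<And>v. C_k_on k (\<lambda>x. f' x v) S"
  shows "C_k_on (Suc k) f S"
proof -
  have "frechet_derivative f (at x) = f' x" if "x \<in> S" for x
    using assms(2)[OF that] frechet_derivative_at by metis
  then have "C_k_on k (\<lambda>x. frechet_derivative f (at x) v) S" for v
    by (intro C_k_on_cong_imp[OF assms(1) _ assms(3)]) simp
  moreover have "\<forall>x\<in>S. f differentiable (at x)"
    using assms(2) unfolding differentiable_def by blast
  ultimately show ?thesis by simp
qed

lemma C_k_on_SucD:
  assumes "C_k_on (Suc k) f S"
  shows "\<exists>f'. (\<forall>x\<in>S. (f has_derivative f' x) (at x)) \<and> (\<forall>v. C_k_on k (\<lambda>x. f' x v) S)"
  using assms by (auto simp: frechet_derivative_works intro!: exI[of _ "\<lambda>x. frechet_derivative f (at x)"])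

lemma C_k_on_continuous: "C_k_on k f S \<Longrightarrow> continuous_on S f"
  by (cases k) (simp_all add: differentiable_imp_continuous_within continuous_at_imp_continuous_on)

lemma C_k_on_lower: "C_k_on (Suc k) f S \<Longrightarrow> C_k_on k f S"
proof (induction k arbitrary: f)
  case 0
  then show ?case using C_k_on_continuous[OF 0] by simp
next
  case (Suc k)
  then show ?case by (metis C_k_on.simps(2))
qed

lemma C_k_on_const: "open S \<Longrightarrow> C_k_on k (\<lambda>x. c) S"
proof (induction k arbitrary: c)
  case (Suc k)
  then show ?case by (intro C_k_on_SucI[where f'="\<lambda>x v. 0"]) auto
qed simp

lemma C_k_on_linear: "open S \<Longrightarrow> bounded_linear L \<Longrightarrow> C_k_on k L S"
proof (cases k)
  case (Suc j)
  assume "open S" "bounded_linear L"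
  then show ?thesis
    unfolding Suc by (intro C_k_on_SucI[where f'="\<lambda>x. L"] C_k_on_const bounded_linear_imp_has_derivative)
qed (simp add: linear_continuous_on)

lemma C_k_on_linear_compose:
  "open S \<Longrightarrow> bounded_linear L \<Longrightarrow> C_k_on k f S \<Longrightarrow> C_k_on k (\<lambda>x. L (f x)) S"
proof (induction k arbitrary: f)
  case 0
  then show ?case by (auto intro: bounded_linear.continuous_on)
next
  case (Suc k)
  obtain f' where "\<And>x. x \<in> S \<Longrightarrow> (f has_derivative f' x) (at x)" 
    "\<And>v. C_k_on k (\<lambda>x. f' x v) S" using C_k_on_SucD[OF Suc.prems(3)] by blast
  then show ?case
    using Suc.IH[OF Suc.prems(1,2)] Suc.prems(1,2)
    by (intro C_k_on_SucI[where f'="\<lambda>x v. L (f' x v)"]) (blast intro: bounded_linear.has_derivative)+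
qed

lemma C_k_on_add:
  "open S \<Longrightarrow> C_k_on k f S \<Longrightarrow> C_k_on k g S \<Longrightarrow> C_k_on k (\<lambda>x. f x + g x) S"
proof (induction k arbitrary: f g)
  case 0
  then show ?case by (simp add: continuous_on_add continuous_on_scaleR)
next
  case (Suc k)
  obtain f' where "\<And>x. x \<in> S \<Longrightarrow> (f has_derivative f' x) (at x)" 
    "\<And>v. C_k_on k (\<lambda>x. f' x v) S" using C_k_on_SucD[OF Suc.prems(2)] by blast
  moreover obtain g' where "\<And>x. x \<in> S \<Longrightarrow> (g has_derivative g' x) (at x)" 
    "\<And>v. C_k_on k (\<lambda>x. g' x v) S" using C_k_on_SucD[OF Suc.prems(3)] by blast
  ultimately show ?case
    using Suc.IH[OF \<open>open S\<close>] \<open>open S\<close>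
    by (intro C_k_on_SucI[where f'="\<lambda>x v. f' x v + g' x v"]) (blast intro: has_derivative_add)+
qed

lemma C_k_on_sum:
  "finite I \<Longrightarrow> open S \<Longrightarrow> (\<And>i. i \<in> I \<Longrightarrow> C_k_on k (f i) S) \<Longrightarrow> C_k_on k (\<lambda>x. \<Sum>i\<in>I. f i x) S"
  by (induction I rule: finite_induct) (auto intro: C_k_on_const C_k_on_add)

lemma C_k_on_scaleR:
  fixes f :: "'a::euclidean_space \<Rightarrow> real" and g :: "'a \<Rightarrow> 'b::euclidean_space"
  shows "open S \<Longrightarrow> C_k_on k f S \<Longrightarrow> C_k_on k g S \<Longrightarrow> C_k_on k (\<lambda>x. f x *\<^sub>R g x) S"
proof (induction k arbitrary: f g)
  case 0
  then show ?case by (simp add: continuous_on_add continuous_on_scaleR)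
next
  case (Suc k)
  obtain f' where "\<And>x. x \<in> S \<Longrightarrow> (f has_derivative f' x) (at x)" 
    "\<And>v. C_k_on k (\<lambda>x. f' x v) S" using C_k_on_SucD[OF Suc.prems(2)] by blast
  moreover obtain g' where "\<And>x. x \<in> S \<Longrightarrow> (g has_derivative g' x) (at x)" 
    "\<And>v. C_k_on k (\<lambda>x. g' x v) S" using C_k_on_SucD[OF Suc.prems(3)] by blast
  ultimately show ?case
  proof (intro C_k_on_SucI[where f'="\<lambda>x v. f x *\<^sub>R g' x v + f' x v *\<^sub>R g x"])
    fix v
    assume "\<And>v. C_k_on k (\<lambda>x. f' x v) S" "\<And>v. C_k_on k (\<lambda>x. g' x v) S"
    then show "C_k_on k (\<lambda>x. f x *\<^sub>R g' x v + f' x v *\<^sub>R g x) S"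
      using C_k_on_lower[OF Suc.prems(2)] C_k_on_lower[OF Suc.prems(3)] \<open>open S\<close>
      by (intro C_k_on_add Suc.IH)
  qed (auto intro: has_derivative_scaleR \<open>open S\<close>)
qed

text \<open>
  The derivative of a composite is linear in the direction, so expanding the inner derivative in
  the basis turns it into a finite sum of products of a scalar function and a composite of lower
  order. This is what lets the induction on the order pass through, although \<open>C_k_on\<close> speaks of
  directional derivatives in constant directions only.
\<close>

lemma C_k_on_compose:
  fixes f :: "'a::euclidean_space \<Rightarrow> 'b::euclidean_space" and g :: "'b \<Rightarrow> 'c::euclidean_space"
  assumes "open S" "open T" "f ` S \<subseteq> T"
  shows "C_k_on k g T \<Longrightarrow> C_k_on k f S \<Longrightarrow> C_k_on k (\<lambda>x. g (f x)) S"
proof (induction k arbitrary: g)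
  case 0
  then show ?case using assms(3) continuous_on_compose2[of T g S f] by simp
next
  case (Suc k)
  obtain f' where f': "\<And>x. x \<in> S \<Longrightarrow> (f has_derivative f' x) (at x)" 
    "\<And>v. C_k_on k (\<lambda>x. f' x v) S" using C_k_on_SucD[OF Suc.prems(2)] by blast
  obtain g' where g': "\<And>x. x \<in> T \<Longrightarrow> (g has_derivative g' x) (at x)" 
    "\<And>v. C_k_on k (\<lambda>x. g' x v) T" using C_k_on_SucD[OF Suc.prems(1)] by blast
  show ?case
  proof (rule C_k_on_SucI[where f'="\<lambda>x v. \<Sum>b\<in>Basis. (f' x v \<bullet> b) *\<^sub>R g' (f x) b"])
    fix x assume x: "x \<in> S"
    have lin: "linear (g' (f x))"
      using g'(1) x assms by (meson has_derivative_linear image_subset_iff)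
    have "g' (f x) (f' x v) = (\<Sum>b\<in>Basis. (f' x v \<bullet> b) *\<^sub>R g' (f x) b)" for v
    proof -
      have "g' (f x) (f' x v) = g' (f x) (\<Sum>b\<in>Basis. (f' x v \<bullet> b) *\<^sub>R b)"
        by (simp add: euclidean_representation)
      then show ?thesis
        by (simp only: linear_sum[OF lin] linear_scale[OF lin])
    qed
    then show "((\<lambda>x. g (f x)) has_derivative (\<lambda>v. \<Sum>b\<in>Basis. (f' x v \<bullet> b) *\<^sub>R g' (f x) b)) (at x)"
      using has_derivative_compose[OF f'(1) g'(1), of x] x assms by auto
  next
    fix v
    show "C_k_on k (\<lambda>x. \<Sum>b\<in>Basis. (f' x v \<bullet> b) *\<^sub>R g' (f x) b) S"
      using assms Suc.IH[OF g'(2) C_k_on_lower[OF Suc.prems(2)]] f'(2)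
      by (intro C_k_on_sum C_k_on_scaleR)
        (auto intro!: C_k_on_linear_compose[where L="\<lambda>x. x \<bullet> b" for b] bounded_linear_inner_left)
  qed (fact assms)
qed

lemma smooth_on_cong_imp:
  "smooth_on S f \<Longrightarrow> open S \<Longrightarrow> (\<And>x. x \<in> S \<Longrightarrow> f x = g x) \<Longrightarrow> smooth_on S g"
  unfolding smooth_on_def using C_k_on_cong_imp by blast

lemma smooth_on_subset: "smooth_on S f \<Longrightarrow> T \<subseteq> S \<Longrightarrow> smooth_on T f"
proof -
  have "C_k_on k f S \<Longrightarrow> T \<subseteq> S \<Longrightarrow> C_k_on k f T" for k
    by (induction k arbitrary: f) (auto intro: continuous_on_subset)
  then show "smooth_on S f \<Longrightarrow> T \<subseteq> S \<Longrightarrow> smooth_on T f"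
    by (auto simp: smooth_on_def)
qed

lemma smooth_on_continuous_on: "smooth_on S f \<Longrightarrow> continuous_on S f"
  using C_k_on_continuous by (auto simp: smooth_on_def)

lemma smooth_on_const: "open S \<Longrightarrow> smooth_on S (\<lambda>x. c)"
  by (simp add: smooth_on_def C_k_on_const)

lemma smooth_on_linear: "open S \<Longrightarrow> bounded_linear L \<Longrightarrow> smooth_on S L"
  by (simp add: smooth_on_def C_k_on_linear)

lemma smooth_on_id: "open S \<Longrightarrow> smooth_on S (\<lambda>x. x)"
  by (simp add: smooth_on_linear bounded_linear_ident)

lemma smooth_on_linear_compose:
  "bounded_linear L \<Longrightarrow> open S \<Longrightarrow> smooth_on S f \<Longrightarrow> smooth_on S (\<lambda>x. L (f x))"
  by (simp add: smooth_on_def C_k_on_linear_compose)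

lemma smooth_on_add:
  "open S \<Longrightarrow> smooth_on S f \<Longrightarrow> smooth_on S g \<Longrightarrow> smooth_on S (\<lambda>x. f x + g x)"
  by (simp add: smooth_on_def C_k_on_add)

lemma smooth_on_scaleR:
  "open S \<Longrightarrow> smooth_on S f \<Longrightarrow> smooth_on S g \<Longrightarrow> smooth_on S (\<lambda>x. f x *\<^sub>R g x)"
  by (simp add: smooth_on_def C_k_on_scaleR)

lemma smooth_on_minus: "open S \<Longrightarrow> smooth_on S f \<Longrightarrow> smooth_on S (\<lambda>x. - f x)"
  by (intro smooth_on_linear_compose[of uminus]) (auto intro: bounded_linear_minus bounded_linear_ident)

lemma smooth_on_diff:
  "open S \<Longrightarrow> smooth_on S f \<Longrightarrow> smooth_on S g \<Longrightarrow> smooth_on S (\<lambda>x. f x - g x)"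
  using smooth_on_add[of S f "\<lambda>x. - g x"] smooth_on_minus[of S g] by simp

lemma smooth_on_mult:
  fixes f g :: "'a::euclidean_space \<Rightarrow> real"
  shows "open S \<Longrightarrow> smooth_on S f \<Longrightarrow> smooth_on S g \<Longrightarrow> smooth_on S (\<lambda>x. f x * g x)"
  using smooth_on_scaleR[of S f g] by simp

lemma smooth_on_power:
  fixes f :: "'a::euclidean_space \<Rightarrow> real"
  shows "open S \<Longrightarrow> smooth_on S f \<Longrightarrow> smooth_on S (\<lambda>x. f x ^ n)"
  by (induction n) (auto intro: smooth_on_const smooth_on_mult)

lemma smooth_on_compose:
  "smooth_on T g \<Longrightarrow> open T \<Longrightarrow> open S \<Longrightarrow> f ` S \<subseteq> T \<Longrightarrow> smooth_on S f \<Longrightarrow> smooth_on S (\<lambda>x. g (f x))"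
  by (simp add: smooth_on_def C_k_on_compose)

lemma smooth_on_frechet_derivative:
  assumes "smooth_on S f"
  shows "smooth_on S (\<lambda>x. frechet_derivative f (at x) v)"
    and "\<And>x. x \<in> S \<Longrightarrow> (f has_derivative frechet_derivative f (at x)) (at x)"
  using assms unfolding smooth_on_def frechet_derivative_works[symmetric]
  by (metis C_k_on.simps(2))+

lemma C_k_on_SucI_vector:
  fixes f :: "real \<Rightarrow> 'b::euclidean_space"
  assumes "open S" "\<And>x. x \<in> S \<Longrightarrow> (f has_vector_derivative f' x) (at x)" "C_k_on k f' S"
  shows "C_k_on (Suc k) f S"
  using assms
  by (intro C_k_on_SucI[where f'="\<lambda>x v. v *\<^sub>R f' x"] C_k_on_scaleR C_k_on_const)
     (auto simp: has_vector_derivative_def)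

lemma continuous_on_vderiv:
  assumes "\<And>x. x \<in> S \<Longrightarrow> (f has_vector_derivative f' x) (at x)"
  shows "continuous_on S f"
  using assms has_vector_derivative_continuous by (blast intro: continuous_at_imp_continuous_on)

text \<open>
  A class of functions of one variable that is closed under differentiation consists of smooth
  functions. Below, the class is a family of integrals with parameter, of series, or of flat functions
  composed with the square root, where one differentiation stays within the family.
\<close>

lemma smooth_on_coinduct:
  fixes P :: "(real \<Rightarrow> 'b::euclidean_space) \<Rightarrow> bool"
  assumes "open S" "P f"
    and "\<And>f. P f \<Longrightarrow> \<exists>f'. P f' \<and> (\<forall>x\<in>S. (f has_vector_derivative f' x) (at x))"
  shows "smooth_on S f"
proof -
  have "P g \<Longrightarrow> C_k_on k g S" for g k
  proof (induction k arbitrary: g)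
    case 0
    then show ?case using assms(3)[OF 0] continuous_on_vderiv by (metis C_k_on.simps(1))
  next
    case (Suc k)
    then show ?case using assms(3)[OF Suc.prems] \<open>open S\<close> C_k_on_SucI_vector by metis
  qed
  then show ?thesis using assms(2) by (simp add: smooth_on_def)
qed

lemma smooth_on_vector_derivative:
  fixes f :: "real \<Rightarrow> 'b::euclidean_space"
  assumes "smooth_on S f" "open S"
  shows "smooth_on S (\<lambda>x. vector_derivative f (at x))"
    and "\<And>x. x \<in> S \<Longrightarrow> (f has_vector_derivative vector_derivative f (at x)) (at x)"
proof -
  have d: "f differentiable (at x)" if "x \<in> S" for x
    using smooth_on_frechet_derivative(2)[OF assms(1) that] unfolding differentiable_def by blast
  then show "\<And>x. x \<in> S \<Longrightarrow> (f has_vector_derivative vector_derivative f (at x)) (at x)"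
    by (simp add: vector_derivative_works)
  show "smooth_on S (\<lambda>x. vector_derivative f (at x))"
    by (rule smooth_on_cong_imp[OF smooth_on_frechet_derivative(1)[OF assms(1), of 1] assms(2)])
      (simp add: d frechet_derivative_eq_vector_derivative)
qed

lemma smooth_on_vderivE:
  fixes f :: "real \<Rightarrow> 'b::euclidean_space"
  assumes "smooth_on S f" "open S"
  obtains f' where "smooth_on S f'" "\<And>x. x \<in> S \<Longrightarrow> (f has_vector_derivative f' x) (at x)"
  using smooth_on_vector_derivative[OF assms] that by blast

lemma smooth_on_inverse:
  fixes f :: "'a::euclidean_space \<Rightarrow> real"
  assumes "smooth_on S f" "open S" "\<And>x. x \<in> S \<Longrightarrow> f x \<noteq> 0"
  shows "smooth_on S (\<lambda>x. inverse (f x))"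
proof -
  have "C_k_on k (inverse :: real \<Rightarrow> real) (- {0})" for k
  proof (induction k)
    case 0
    show ?case by (auto intro: continuous_intros)
  next
    case (Suc k)
    show ?case
    proof (rule C_k_on_SucI_vector[where f'="\<lambda>x. (- inverse x) *\<^sub>R inverse x"])
      show "C_k_on k (\<lambda>x. (- inverse x) *\<^sub>R inverse x) (- {0::real})"
        using C_k_on_linear_compose[OF _ bounded_linear_minus[OF bounded_linear_ident] Suc] Suc
        by (intro C_k_on_scaleR) auto
    qed (auto intro!: derivative_eq_intros simp flip: has_real_derivative_iff_has_vector_derivative)
  qed
  then have "smooth_on (- {0}) (inverse :: real \<Rightarrow> real)" by (simp add: smooth_on_def)
  then show ?thesis
    by (rule smooth_on_compose[where T="- {0}"]) (use assms in auto)
qed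

lemma smooth_on_divide:
  fixes f g :: "'a::euclidean_space \<Rightarrow> real"
  assumes "open S" "smooth_on S f" "smooth_on S g" "\<And>x. x \<in> S \<Longrightarrow> g x \<noteq> 0"
  shows "smooth_on S (\<lambda>x. f x / g x)"
  unfolding divide_inverse by (intro smooth_on_mult smooth_on_inverse assms)

lemma smooth_on_sqrt:
  fixes f :: "'a::euclidean_space \<Rightarrow> real"
  assumes "smooth_on S f" "open S" "\<And>x. x \<in> S \<Longrightarrow> f x > 0"
  shows "smooth_on S (\<lambda>x. sqrt (f x))"
proof -
  have "C_k_on k sqrt {0<..}" for k
  proof (induction k)
    case 0
    show ?case by (auto intro: continuous_intros)
  next
    case (Suc k)
    have *: "smooth_on {0<..} (\<lambda>x::real. inverse (2 * x))"
      by (intro smooth_on_inverse smooth_on_mult smooth_on_const smooth_on_id) auto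
    show ?case
    proof (rule C_k_on_SucI_vector[where f'="\<lambda>x. inverse (2 * x) *\<^sub>R sqrt x"])
      show "C_k_on k (\<lambda>x. inverse (2 * x) *\<^sub>R sqrt x) {0<..}"
        using * Suc by (intro C_k_on_scaleR) (auto simp: smooth_on_def)
    next
      fix x :: real assume "x \<in> {0<..}"
      then show "(sqrt has_vector_derivative inverse (2 * x) *\<^sub>R sqrt x) (at x)"
        by (auto intro!: derivative_eq_intros simp: field_simps simp flip: has_real_derivative_iff_has_vector_derivative)
    qed simp
  qed
  then have "smooth_on {0<..} sqrt" by (simp add: smooth_on_def)
  then show ?thesis
    by (rule smooth_on_compose[where T="{0<..}"]) (use assms in auto)
qed

text \<open>
  The span of sine and cosine is closed under differentiation.
\<close>

lemma smooth_on_sin_cos: "smooth_on UNIV (sin::real\<Rightarrow>real)" "smooth_on UNIV (cos::real\<Rightarrow>real)"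
proof -
  have "smooth_on UNIV (\<lambda>t. a * sin t + b * cos t)" for a b :: real
  proof (rule smooth_on_coinduct[where P="\<lambda>f. \<exists>a b. f = (\<lambda>t. a * sin t + b * cos t)"])
    fix f :: "real \<Rightarrow> real" assume "\<exists>a b. f = (\<lambda>t. a * sin t + b * cos t)"
    then obtain a b where f: "f = (\<lambda>t. a * sin t + b * cos t)" by blast
    have "(f has_vector_derivative (- b) * sin x + a * cos x) (at x)" for x
      unfolding f by (auto intro!: derivative_eq_intros simp flip: has_real_derivative_iff_has_vector_derivative)
    then show "\<exists>f'. (\<exists>a b. f' = (\<lambda>t. a * sin t + b * cos t)) \<and> (\<forall>x\<in>UNIV. (f has_vector_derivative f' x) (at x))"
      by blast
  qed auto
  from this[of 1 0] this[of 0 1] show "smooth_on UNIV (sin::real\<Rightarrow>real)" "smooth_on UNIV (cos::real\<Rightarrow>real)"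
    by simp_all
qed

lemma smooth_on_norm:
  fixes f :: "'a::euclidean_space \<Rightarrow> 'b::euclidean_space"
  assumes "smooth_on S f" "open S" "\<And>x. x \<in> S \<Longrightarrow> f x \<noteq> 0"
  shows "smooth_on S (\<lambda>x. norm (f x))"
proof -
  have "smooth_on S (\<lambda>x. \<Sum>b\<in>Basis. (f x \<bullet> b)\<^sup>2)"
    unfolding smooth_on_def
    using assms smooth_on_power[OF assms(2) smooth_on_linear_compose[OF bounded_linear_inner_left assms(2,1)]]
    by (auto intro!: C_k_on_sum simp: smooth_on_def)
  then have "smooth_on S (\<lambda>x. sqrt (\<Sum>b\<in>Basis. (f x \<bullet> b)\<^sup>2))"
  proof (rule smooth_on_sqrt[OF _ assms(2)])
    fix x assume "x \<in> S"
    then have "(norm (f x))\<^sup>2 > 0" using assms by auto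
    then show "(\<Sum>b\<in>Basis. (f x \<bullet> b)\<^sup>2) > 0"
      by (subst (asm) power2_norm_eq_inner, subst (asm) euclidean_inner) (simp add: power2_eq_square)
  qed
  then show ?thesis
    by (simp add: norm_eq_sqrt_inner euclidean_inner[of "f _" "f _"] power2_eq_square)
qed

section \<open>Moments and division by powers of the parameter\<close>

text \<open>
  For \<open>t \<noteq> 0\<close> this is \<open>1 / t ^ (n + 1)\<close> times the integral of \<open>u ^ n * f u\<close> from \<open>0\<close> to \<open>t\<close>.
  The integral over the fixed interval is the smooth continuation to \<open>t = 0\<close>.
\<close>

definition moment :: "nat \<Rightarrow> (real \<Rightarrow> 'b::euclidean_space) \<Rightarrow> real \<Rightarrow> 'b" where
  "moment n f t = integral {0..1} (\<lambda>s. s ^ n *\<^sub>R f (s * t))"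

lemma mult_mem_interval:
  fixes e s t :: real
  assumes "0 \<le> s" "s \<le> 1" "t \<in> {-e<..<e}"
  shows "s * t \<in> {-e<..<e}"
proof -
  have "\<bar>s * t\<bar> \<le> \<bar>t\<bar>"
    using assms by (simp add: abs_mult mult_left_le_one_le)
  then show ?thesis using assms by auto
qed

lemma has_vector_derivative_moment:
  fixes f :: "real \<Rightarrow> 'b::euclidean_space"
  assumes f': "\<And>x. x \<in> {-e<..<e} \<Longrightarrow> (f has_vector_derivative f' x) (at x)"
    and cont: "continuous_on {-e<..<e} f'" and t: "t \<in> {-e<..<e}"
  shows "(moment n f has_vector_derivative moment (Suc n) f' t) (at t)"
proof -
  let ?U = "{-e<..<e}"
  have contf: "continuous_on ?U f"
    using f' by (rule continuous_on_vderiv)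
  have "((\<lambda>t. integral (cbox 0 1) (\<lambda>s. s ^ n *\<^sub>R f (s * t))) has_vector_derivative
     integral (cbox 0 1) (\<lambda>s. s ^ Suc n *\<^sub>R f' (s * t))) (at t within ?U)"
  proof (rule leibniz_rule_vector_derivative)
    fix x s :: real assume "x \<in> ?U" "s \<in> cbox 0 1"
    then have m: "s * x \<in> ?U" by (intro mult_mem_interval) auto
    have "((\<lambda>x. f (s * x)) has_vector_derivative s *\<^sub>R f' (s * x)) (at x)"
      using vector_diff_chain_at[where f="\<lambda>x. s * x" and f'=s and x=x, OF _ f'[OF m]]
        has_vector_derivative_mult_right[OF has_vector_derivative_id[of "at x"], of s]
      by (simp add: o_def)
    then have "((\<lambda>x. s ^ n *\<^sub>R f (s * x)) has_vector_derivative s ^ n *\<^sub>R s *\<^sub>R f' (s * x)) (at x)"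
      using bounded_linear.has_vector_derivative[OF bounded_linear_scaleR_right] by blast
    then show "((\<lambda>x. s ^ n *\<^sub>R f (s * x)) has_vector_derivative s ^ Suc n *\<^sub>R f' (s * x)) (at x within ?U)"
      by (simp add: has_vector_derivative_at_within mult.commute)
  next
    fix x assume "x \<in> ?U"
    then show "(\<lambda>s. s ^ n *\<^sub>R f (s * x)) integrable_on cbox 0 1"
      by (intro integrable_continuous continuous_intros continuous_on_compose2[OF contf])
        (auto intro!: mult_mem_interval simp del: greaterThanLessThan_iff)
  next
    show "continuous_on (?U \<times> cbox 0 1) (\<lambda>(x, s). s ^ Suc n *\<^sub>R f' (s * x))"
      unfolding case_prod_beta
      by (intro continuous_intros continuous_on_compose2[OF cont])
        (auto intro!: mult_mem_interval simp del: greaterThanLessThan_iff)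
  qed (use t in auto)
  then have "(moment n f has_vector_derivative moment (Suc n) f' t) (at t within ?U)"
    unfolding moment_def[abs_def] box_real .
  then show ?thesis using at_within_open[OF t open_greaterThanLessThan] by argo
qed

text \<open>
  Moments are closed under differentiation, because the derivative of the \<open>n\<close>-th moment of \<open>f\<close> is
  the moment of order \<open>n + 1\<close> of \<open>f'\<close>.
\<close>

lemma smooth_on_moment:
  fixes f :: "real \<Rightarrow> 'b::euclidean_space"
  assumes "smooth_on {-e<..<e} f"
  shows "smooth_on {-e<..<e} (moment n f)"
proof (rule smooth_on_coinduct[where P="\<lambda>g. \<exists>n f. smooth_on {-e<..<e} f \<and> g = moment n f"])
  fix g :: "real \<Rightarrow> 'b" assume "\<exists>n f. smooth_on {-e<..<e} f \<and> g = moment n f"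
  then obtain n f where f: "smooth_on {-e<..<e} f" "g = moment n f" by blast
  then obtain f' where "smooth_on {-e<..<e} f'" "\<And>x. x \<in> {-e<..<e} \<Longrightarrow> (f has_vector_derivative f' x) (at x)"
    using smooth_on_vderivE[of "{-e<..<e}" f] by (metis open_greaterThanLessThan)
  then show "\<exists>f'. (\<exists>n f. smooth_on {-e<..<e} f \<and> f' = moment n f) \<and>
     (\<forall>x\<in>{-e<..<e}. (g has_vector_derivative f' x) (at x))"
    using has_vector_derivative_moment f smooth_on_continuous_on by metis
qed (use assms in auto)

lemma moment_by_parts:
  fixes f :: "real \<Rightarrow> 'b::euclidean_space"
  assumes f': "\<And>x. x \<in> {-e<..<e} \<Longrightarrow> (f has_vector_derivative f' x) (at x)"
    and cont: "continuous_on {-e<..<e} f'" and t: "t \<in> {-e<..<e}"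
  shows "f t = real (Suc n) *\<^sub>R moment n f t + t *\<^sub>R moment (Suc n) f' t"
proof -
  have contf: "continuous_on {-e<..<e} f"
    using f' by (rule continuous_on_vderiv)
  have m: "s * t \<in> {-e<..<e}" if "s \<in> {0..1}" for s
    using t that by (intro mult_mem_interval) auto
  have 1: "((\<lambda>s. s ^ n *\<^sub>R f (s * t)) has_integral moment n f t) {0..1}"
    unfolding moment_def using m
    by (intro integrable_integral integrable_continuous_real continuous_intros continuous_on_compose2[OF contf])
       (auto simp del: greaterThanLessThan_iff)
  have 2: "((\<lambda>s. s ^ Suc n *\<^sub>R f' (s * t)) has_integral moment (Suc n) f' t) {0..1}"
    unfolding moment_def using m
    by (intro integrable_integral integrable_continuous_real continuous_intros continuous_on_compose2[OF cont])
       (auto simp del: greaterThanLessThan_iff)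
  have d: "((\<lambda>s. s ^ Suc n *\<^sub>R f (s * t)) has_vector_derivative
      real (Suc n) *\<^sub>R (s ^ n *\<^sub>R f (s * t)) + t *\<^sub>R (s ^ Suc n *\<^sub>R f' (s * t))) (at s within {0..1})"
    if s: "s \<in> {0..1}" for s
  proof -
    have "((\<lambda>s. f (s * t)) has_vector_derivative t *\<^sub>R f' (s * t)) (at s)"
      using vector_diff_chain_at[where f="\<lambda>s. s * t" and f'=t and x=s, OF _ f'[OF m[OF s]]]
        has_vector_derivative_mult_left[OF has_vector_derivative_id[of "at s"], of t]
      by (simp add: o_def)
    note has_vector_derivative_scaleR[OF DERIV_pow[of "Suc n" s UNIV] this]
    also have "s ^ Suc n *\<^sub>R (t *\<^sub>R f' (s * t)) + (real (Suc n) * s ^ (Suc n - Suc 0)) *\<^sub>R f (s * t) =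
      real (Suc n) *\<^sub>R (s ^ n *\<^sub>R f (s * t)) + t *\<^sub>R (s ^ Suc n *\<^sub>R f' (s * t))"
      by (simp add: mult.commute[of t])
    finally show ?thesis
      by (rule has_vector_derivative_at_within)
  qed
  have "((\<lambda>s. real (Suc n) *\<^sub>R (s ^ n *\<^sub>R f (s * t)) + t *\<^sub>R (s ^ Suc n *\<^sub>R f' (s * t))) has_integral
     1 ^ Suc n *\<^sub>R f (1 * t) - 0 ^ Suc n *\<^sub>R f (0 * t)) {0..1}"
    using fundamental_theorem_of_calculus[OF _ d] by simp
  moreover have "((\<lambda>s. real (Suc n) *\<^sub>R (s ^ n *\<^sub>R f (s * t)) + t *\<^sub>R (s ^ Suc n *\<^sub>R f' (s * t))) has_integral
     real (Suc n) *\<^sub>R moment n f t + t *\<^sub>R moment (Suc n) f' t) {0..1}"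
    by (rule has_integral_add[OF has_integral_cmul[OF 1] has_integral_cmul[OF 2]])
  ultimately have "1 ^ Suc n *\<^sub>R f (1 * t) - 0 ^ Suc n *\<^sub>R f (0 * t) =
      real (Suc n) *\<^sub>R moment n f t + t *\<^sub>R moment (Suc n) f' t"
    by (rule has_integral_unique)
  then show ?thesis by simp
qed

text \<open>
  Division of a primitive of \<open>t ^ n * f t\<close> by \<open>t ^ (n + 1)\<close> loses no smoothness. With \<open>n = 1\<close> this
  exhibits the arclength of a cusp as \<open>t\<^sup>2\<close> times a smooth function, up to sign; with \<open>n = 1\<close> and
  \<open>n = 2\<close> it gives the coordinates of a cusp with prescribed velocity.
\<close>

lemma smooth_moment:
  fixes f :: "real \<Rightarrow> 'b::euclidean_space"
  assumes "smooth_on {-e<..<e} f"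
  obtains g where "smooth_on {-e<..<e} g"
    "\<And>t. t \<in> {-e<..<e} \<Longrightarrow> ((\<lambda>t. t ^ Suc n *\<^sub>R g t) has_vector_derivative t ^ n *\<^sub>R f t) (at t)"
    "e > 0 \<Longrightarrow> real (Suc n) *\<^sub>R g 0 = f 0"
proof -
  obtain f' where f': "smooth_on {-e<..<e} f'" "\<And>x. x \<in> {-e<..<e} \<Longrightarrow> (f has_vector_derivative f' x) (at x)"
    using smooth_on_vderivE[OF assms] by auto
  have parts: "f t = real (Suc n) *\<^sub>R moment n f t + t *\<^sub>R moment (Suc n) f' t" if "t \<in> {-e<..<e}" for t n
    using that by (intro moment_by_parts[OF _ smooth_on_continuous_on[OF f'(1)]] f')
  show thesis
  proof
    show "smooth_on {-e<..<e} (moment n f)" using assms by (rule smooth_on_moment)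
  next
    fix t assume t: "t \<in> {-e<..<e}"
    have "(moment n f has_vector_derivative moment (Suc n) f' t) (at t)"
      by (rule has_vector_derivative_moment[OF f'(2) smooth_on_continuous_on[OF f'(1)] t])
    note has_vector_derivative_scaleR[OF DERIV_pow[of "Suc n" t UNIV] this]
    also have "t ^ Suc n *\<^sub>R moment (Suc n) f' t + (real (Suc n) * t ^ (Suc n - Suc 0)) *\<^sub>R moment n f t
      = t ^ n *\<^sub>R (real (Suc n) *\<^sub>R moment n f t + t *\<^sub>R moment (Suc n) f' t)"
      by (simp add: algebra_simps)
    finally show "((\<lambda>t. t ^ Suc n *\<^sub>R moment n f t) has_vector_derivative t ^ n *\<^sub>R f t) (at t)"
      using parts[OF t, of n] by simp
  next
    assume "e > 0"
    then show "real (Suc n) *\<^sub>R moment n f 0 = f 0" using parts[of 0 n] by auto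
  qed
qed

lemma vector_derivative_eq_imp_eq:
  fixes f g :: "real \<Rightarrow> 'b::euclidean_space"
  assumes "\<And>x. x \<in> {-e<..<e} \<Longrightarrow> (f has_vector_derivative h x) (at x)"
    "\<And>x. x \<in> {-e<..<e} \<Longrightarrow> (g has_vector_derivative h x) (at x)"
    "f 0 = g 0" "t \<in> {-e<..<e}"
  shows "f t = g t"
proof -
  have "((\<lambda>x. f x - g x) has_derivative (\<lambda>v. 0)) (at x within {-e<..<e})" if "x \<in> {-e<..<e}" for x
    using has_vector_derivative_diff[OF assms(1,2)[OF that]] 
    by (simp add: has_vector_derivative_def has_derivative_at_withinI)
  then have "f t - g t = f 0 - g 0"
    using assms(4) by (intro has_derivative_zero_unique[of "{-e<..<e}" "\<lambda>x. f x - g x" t 0]) auto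
  with assms(3) show ?thesis by simp
qed

lemma Hadamard:
  fixes f :: "real \<Rightarrow> 'b::euclidean_space"
  assumes "smooth_on {-e<..<e} f" 
  obtains g where "smooth_on {-e<..<e} g" "\<And>t. t \<in> {-e<..<e} \<Longrightarrow> f t = f 0 + t *\<^sub>R g t"
proof -
  obtain f' where f': "smooth_on {-e<..<e} f'" "\<And>x. x \<in> {-e<..<e} \<Longrightarrow> (f has_vector_derivative f' x) (at x)"
    using smooth_on_vderivE[OF assms] by auto
  obtain g where g: "smooth_on {-e<..<e} g"
    "\<And>t. t \<in> {-e<..<e} \<Longrightarrow> ((\<lambda>t. t ^ Suc 0 *\<^sub>R g t) has_vector_derivative t ^ 0 *\<^sub>R f' t) (at t)"
    using smooth_moment[OF f'(1)] by metis
  show thesis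
  proof
    fix t assume t: "t \<in> {-e<..<e}"
    have "((\<lambda>t. f 0 + t *\<^sub>R g t) has_vector_derivative f' x) (at x)" if "x \<in> {-e<..<e}" for x
      using has_vector_derivative_add[OF has_vector_derivative_const g(2)[OF that]] by simp
    with f'(2) show "f t = f 0 + t *\<^sub>R g t"
      by (rule vector_derivative_eq_imp_eq) (use t in auto)
  qed (fact g)
qed

section \<open>Germs at the origin and local inverses on the line\<close>

lemma smooth_atI: "smooth_on S f \<Longrightarrow> open S \<Longrightarrow> x \<in> S \<Longrightarrow> smooth_at f x"
  unfolding smooth_at_def by blast

lemma smooth_at_0_interval:
  fixes f :: "real \<Rightarrow> 'b::euclidean_space"
  assumes "smooth_at f 0"
  obtains d where "d > 0" "smooth_on {-d<..<d} f"
proof -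
  obtain S where S: "open S" "0 \<in> S" "smooth_on S f" using assms unfolding smooth_at_def by blast
  then obtain d where "d > 0" "ball 0 d \<subseteq> S" using open_contains_ball by blast
  moreover have "{-d<..<d} = ball 0 d" by (auto simp: dist_norm)
  ultimately show thesis using that[of d] smooth_on_subset[OF S(3)] by simp
qed

lemma eventually_nhds_0_interval:
  "(\<forall>\<^sub>F u in nhds (0::real). P u) \<longleftrightarrow> (\<exists>d>0. \<forall>u\<in>{-d<..<d}. P u)"
  unfolding eventually_nhds_metric by (auto simp: dist_norm abs_less_iff)

lemma diffeomorphism_sym: "diffeomorphism U V f g \<Longrightarrow> diffeomorphism V U g f"
  unfolding diffeomorphism_def using homeomorphism_symD by blast

text \<open>
  A positive derivative makes the function strictly increasing near \<open>0\<close>, hence a homeomorphism onto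
  an open set. The inverse \<open>g\<close> satisfies \<open>g' = 1 / (f' \<circ> g)\<close>, so each order of differentiability
  of \<open>g\<close> yields the next.
\<close>

lemma inverse_function_1d:
  fixes f :: "real \<Rightarrow> real"
  assumes f: "smooth_on {-e<..<e} f" and e: "e > 0" and c: "(f has_real_derivative c) (at 0)" "c > 0"
  obtains d g where "0 < d" "d \<le> e" "diffeomorphism {-d<..<d} (f ` {-d<..<d}) f g"
proof -
  obtain f' where f': "smooth_on {-e<..<e} f'" 
    "\<And>x. x \<in> {-e<..<e} \<Longrightarrow> (f has_vector_derivative f' x) (at x)"
    using smooth_on_vderivE[OF f] by auto
  have D: "(f has_real_derivative f' x) (at x)" if "x \<in> {-e<..<e}" for x
    using f'(2)[OF that] by (simp add: has_real_derivative_iff_has_vector_derivative)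
  have "f' 0 = c" using D[of 0] c(1) e DERIV_unique by auto
  have "isCont f' 0"
    using smooth_on_continuous_on[OF f'(1)] e by (simp add: continuous_on_eq_continuous_at)
  then have "(f' \<longlongrightarrow> f' 0) (nhds 0)" by (simp add: isCont_def tendsto_nhds_iff)
  then have "\<forall>\<^sub>F x in nhds 0. f' x > 0" 
    by (rule order_tendstoD(1)) (use \<open>f' 0 = c\<close> c(2) in simp)
  then obtain d0 where d0: "d0 > 0" "\<forall>x\<in>{-d0<..<d0}. f' x > 0"
    unfolding eventually_nhds_0_interval by blast
  define d where "d = min d0 e"
  let ?U = "{-d<..<d}"
  have U: "?U \<subseteq> {-e<..<e}" by (auto simp: d_def)
  have pos: "f' x > 0" if "x \<in> ?U" for x using d0 that by (auto simp: d_def)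
  have less: "f x < f y" if "x \<in> ?U" "y \<in> ?U" "x < y" for x y
  proof (rule DERIV_pos_imp_increasing[OF \<open>x < y\<close>])
    fix z assume "x \<le> z" "z \<le> y"
    then have "z \<in> ?U" using that by auto
    then show "\<exists>c. (f has_real_derivative c) (at z) \<and> c > 0" using D pos U by blast
  qed
  have inj: "inj_on f ?U" 
    by (rule linorder_inj_onI') (use less in force)
  have cont: "continuous_on ?U f" using smooth_on_continuous_on[OF f] continuous_on_subset U by blast
  obtain g where g: "homeomorphism ?U (f ` ?U) f g"
    using injective_into_1d_eq_homeomorphism[OF cont] inj 
    by (meson convex_imp_path_connected convex_real_interval(8))
  have op: "open (f ` ?U)"
    by (rule injective_into_1d_imp_open_map_UNIV[OF _ cont inj]) auto
  have gU: "g y \<in> ?U" and fg: "f (g y) = y" if "y \<in> f ` ?U" for y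
    using g that unfolding homeomorphism_def by blast+
  have Dg: "(g has_vector_derivative inverse (f' (g y))) (at y)" if y: "y \<in> f ` ?U" for y
    unfolding has_real_derivative_iff_has_vector_derivative[symmetric]
  proof (rule has_field_derivative_inverse_basic[where f=f and t="f ` ?U"])
    show "(f has_real_derivative f' (g y)) (at (g y))" using D gU[OF y] U by blast
    show "f' (g y) \<noteq> 0" using pos[OF gU[OF y]] by simp
    show "continuous (at y) g"
    proof -
      have "continuous_on (f ` ?U) g" using g unfolding homeomorphism_def by blast
      then show ?thesis using continuous_on_eq_continuous_at[OF op] y by blast
    qed
  qed (use op y fg in auto)
  have h: "smooth_on ?U (\<lambda>x. inverse (f' x))"
    using smooth_on_inverse[OF smooth_on_subset[OF f'(1) U]] pos by force
  have "C_k_on k g (f ` ?U)" for k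
  proof (induction k)
    case 0
    show ?case using g unfolding homeomorphism_def by simp
  next
    case (Suc k)
    show ?case
    proof (rule C_k_on_SucI_vector[OF op Dg])
      show "C_k_on k (\<lambda>y. inverse (f' (g y))) (f ` ?U)"
        by (rule C_k_on_compose[where T="?U", OF op _ _ _ Suc]) (use gU h in \<open>auto simp: smooth_on_def\<close>)
    qed
  qed
  then have "diffeomorphism ?U (f ` ?U) f g"
    unfolding diffeomorphism_def using g op smooth_on_subset[OF f U] by (simp add: smooth_on_def)
  then show thesis using that[of d g] d0 e by (simp add: d_def)
qed

section \<open>A smooth bump function\<close>

definition exp_flat :: "nat \<Rightarrow> real \<Rightarrow> real" where
  "exp_flat n x = (if x > 0 then (1 / x) ^ n * exp (- (1 / x)) else 0)"

lemma exp_flat_tendsto_0: "(exp_flat n \<longlongrightarrow> 0) (at 0)"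
proof -
  have "((\<lambda>x. (1 / x) ^ n / exp (1 / x)) \<longlongrightarrow> (0::real)) (at_right 0)"
    by (rule filterlim_compose[OF tendsto_power_div_exp_0]) 
       (simp add: filterlim_inverse_at_top_right flip: inverse_eq_divide)
  then have "(exp_flat n \<longlongrightarrow> 0) (at_right 0)"
    by (rule Lim_transform_eventually)
      (auto simp: exp_flat_def exp_minus divide_inverse eventually_at_right_less intro: eventually_mono[OF eventually_at_right_less])
  moreover have "(exp_flat n \<longlongrightarrow> 0) (at_left 0)"
    by (rule tendsto_eventually) (auto simp: exp_flat_def eventually_at_filter)
  ultimately show ?thesis by (simp add: filterlim_at_split)
qed

lemma exp_flat_deriv: "(exp_flat n has_real_derivative exp_flat (n + 2) x - real n * exp_flat (n + 1) x) (at x)"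
proof -
  consider "x > 0" | "x < 0" | "x = 0" by linarith
  then show ?thesis
  proof cases
    case 1
    have "((\<lambda>x. (1 / x) ^ n * exp (- (1 / x))) has_real_derivative
       exp_flat (n + 2) x - real n * exp_flat (n + 1) x) (at x)"
    proof -
      let ?y = "1 / x"
      have "((\<lambda>y. y ^ n * exp (- y)) has_real_derivative
          real n * ?y ^ (n - Suc 0) * exp (- ?y) - ?y ^ n * exp (- ?y)) (at ?y)"
        by (auto intro!: derivative_eq_intros)
      moreover have "((\<lambda>x. 1 / x) has_real_derivative - (?y\<^sup>2)) (at x)"
        using 1 by (auto intro!: derivative_eq_intros simp: power2_eq_square)
      ultimately have "((\<lambda>x. (1 / x) ^ n * exp (- (1 / x))) has_real_derivative
          (real n * ?y ^ (n - Suc 0) * exp (- ?y) - ?y ^ n * exp (- ?y)) * (- (?y\<^sup>2))) (at x)"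
        by (rule DERIV_chain2)
      also have "(real n * ?y ^ (n - Suc 0) * exp (- ?y) - ?y ^ n * exp (- ?y)) * (- (?y\<^sup>2)) =
          ?y ^ (n + 2) * exp (- ?y) - (real n * ?y ^ (n - Suc 0) * ?y\<^sup>2) * exp (- ?y)"
        by (simp only: power_add) (simp add: algebra_simps)
      also have "real n * ?y ^ (n - Suc 0) * ?y\<^sup>2 = real n * ?y ^ (n + 1)"
        by (cases n) (simp_all add: power2_eq_square)
      finally show ?thesis using 1 by (simp add: exp_flat_def mult.assoc)
    qed
    then show ?thesis
      by (rule has_field_derivative_transform_within_open[where S="{0<..}"]) (use 1 in \<open>auto simp: exp_flat_def\<close>)
  next
    case 2
    have "((\<lambda>x. 0) has_real_derivative exp_flat (n + 2) x - real n * exp_flat (n + 1) x) (at x)"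
      using 2 by (simp add: exp_flat_def)
    then show ?thesis
      by (rule has_field_derivative_transform_within_open[where S="{..<0}"]) (use 2 in \<open>auto simp: exp_flat_def\<close>)
  next
    case 3
    have "(\<lambda>h. (exp_flat n (0 + h) - exp_flat n 0) / h) = exp_flat (Suc n)"
      by (auto simp: exp_flat_def)
    then show ?thesis
      unfolding 3 DERIV_def using exp_flat_tendsto_0[of "Suc n"] by (simp add: exp_flat_def)
  qed
qed

text \<open>
  The derivative of \<open>exp_flat n\<close> is a combination of \<open>exp_flat (n + 2)\<close> and \<open>exp_flat (n + 1)\<close>,
  so the order of differentiability grows for all \<open>n\<close> at once.
\<close>

lemma smooth_on_exp_flat: "smooth_on UNIV (exp_flat n)"
proof -
  have "C_k_on k (exp_flat n) UNIV" for k
  proof (induction k arbitrary: n)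
    case 0
    show ?case using exp_flat_deriv by (auto intro!: continuous_at_imp_continuous_on DERIV_isCont)
  next
    case (Suc k)
    show ?case
    proof (rule C_k_on_SucI_vector)
      show "C_k_on k (\<lambda>x. exp_flat (n + 2) x + (- real n) *\<^sub>R exp_flat (n + 1) x) UNIV"
        by (rule C_k_on_add[OF _ Suc C_k_on_scaleR[OF _ C_k_on_const Suc]]) auto
    qed (use exp_flat_deriv[of n] in \<open>auto simp: has_real_derivative_iff_has_vector_derivative\<close>)
  qed
  then show ?thesis by (simp add: smooth_on_def)
qed

lemma bump_function:
  obtains \<beta> :: "real \<Rightarrow> real" where "smooth_on UNIV \<beta>"
    "\<And>x. \<bar>x\<bar> \<le> 1 \<Longrightarrow> \<beta> x = 1" "\<And>x. \<bar>x\<bar> \<ge> 2 \<Longrightarrow> \<beta> x = 0"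
proof
  let ?u = "\<lambda>x::real. exp_flat 0 (4 - x^2)" and ?v = "\<lambda>x::real. exp_flat 0 (x^2 - 1)"
  have pos: "?u x + ?v x > 0" for x :: real
    by (auto simp: exp_flat_def add_pos_nonneg add_pos_pos)
  have u: "smooth_on UNIV ?u" and v: "smooth_on UNIV ?v"
    by (rule smooth_on_compose[OF smooth_on_exp_flat]; 
        (rule smooth_on_diff smooth_on_const smooth_on_power smooth_on_id)?; 
        auto intro!: smooth_on_const smooth_on_power smooth_on_id)+
  show "smooth_on UNIV (\<lambda>x. ?u x / (?u x + ?v x))"
    by (rule smooth_on_divide[OF _ u smooth_on_add[OF _ u v]]) (use pos in \<open>auto simp: less_imp_neq[symmetric]\<close>)
  fix x :: real
  show "?u x / (?u x + ?v x) = 1" if "\<bar>x\<bar> \<le> 1"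
  proof -
    have "?v x = 0" using that abs_square_le_1[of x] by (simp add: exp_flat_def)
    with pos[of x] show ?thesis by simp
  qed
  show "?u x / (?u x + ?v x) = 0" if "\<bar>x\<bar> \<ge> 2"
    using power_mono[OF that, of 2] by (simp add: exp_flat_def)
qed

section \<open>Realization of Taylor coefficients\<close>

lemma smooth_on_UNIV_deriv:
  fixes f :: "real \<Rightarrow> real"
  assumes "smooth_on UNIV f"
  shows "smooth_on UNIV (deriv f)" "(f has_real_derivative deriv f x) (at x)"
proof -
  have *: "(f has_real_derivative vector_derivative f (at x)) (at x)" for x
    using smooth_on_vector_derivative(2)[OF assms] by (simp add: has_real_derivative_iff_has_vector_derivative)
  have "vector_derivative f (at x) = deriv f x" for x
    using DERIV_imp_deriv[OF *] by simp
  with * show "smooth_on UNIV (deriv f)" "(f has_real_derivative deriv f x) (at x)"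
    using smooth_on_vector_derivative(1)[OF assms] by simp_all
qed

lemma smooth_on_UNIV_deriv_funpow:
  fixes f :: "real \<Rightarrow> real"
  shows "smooth_on UNIV f \<Longrightarrow> smooth_on UNIV ((deriv ^^ j) f)"
  by (induction j) (auto intro: smooth_on_UNIV_deriv)

text \<open>
  Compressing the argument by the factor \<open>m\<close> costs \<open>m ^ j\<close> in the \<open>j\<close>-th derivative. Against the
  prefactor \<open>1 / m ^ k\<close> of a cut-off monomial of degree \<open>k > j\<close> this is a gain of \<open>1 / m\<close> at least,
  and here lies the convergence in Borel's theorem.
\<close>

lemma deriv_funpow_scale:
  fixes f :: "real \<Rightarrow> real"
  assumes "smooth_on UNIV f"
  shows "(deriv ^^ j) (\<lambda>x. c * f (m * x)) = (\<lambda>x. c * m ^ j * (deriv ^^ j) f (m * x))"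
proof (induction j)
  case (Suc j)
  have "((\<lambda>x. c * m ^ j * (deriv ^^ j) f (m * x)) has_real_derivative
     c * m ^ Suc j * deriv ((deriv ^^ j) f) (m * x)) (at x)" for x
  proof -
    have "((\<lambda>x. (deriv ^^ j) f (m * x)) has_real_derivative deriv ((deriv ^^ j) f) (m * x) * m) (at x)"
      by (rule DERIV_chain2[where g="\<lambda>x. m * x", OF smooth_on_UNIV_deriv(2)[OF smooth_on_UNIV_deriv_funpow[OF assms]]])
        (auto intro!: derivative_eq_intros)
    from DERIV_cmult[OF this, of "c * m ^ j"] show ?thesis by (simp add: mult_ac)
  qed
  then show ?case using Suc by (auto simp: DERIV_imp_deriv)
qed simp

lemma bounded_deriv_funpow:
  fixes f :: "real \<Rightarrow> real"
  assumes "smooth_on UNIV f" "\<And>x. \<bar>x\<bar> > b \<Longrightarrow> f x = 0"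
  shows "\<exists>K\<ge>0. \<forall>x. \<bar>(deriv ^^ j) f x\<bar> \<le> K"
proof -
  have 0: "\<bar>x\<bar> > b \<Longrightarrow> (deriv ^^ j) f x = 0" for x
  proof (induction j arbitrary: x)
    case (Suc j)
    have "open {x. \<bar>x\<bar> > b}" by (intro open_Collect_less continuous_intros)
    have "((\<lambda>x. 0) has_real_derivative 0) (at x)" by simp
    then have "((deriv ^^ j) f has_real_derivative 0) (at x)"
      by (rule has_field_derivative_transform_within_open[OF _ \<open>open {x. \<bar>x\<bar> > b}\<close>]) (use Suc in auto)
    then show ?case by (simp add: DERIV_imp_deriv)
  qed (simp add: assms)
  have "compact ((deriv ^^ j) f ` {-b..b})"
    using smooth_on_continuous_on[OF smooth_on_UNIV_deriv_funpow[OF assms(1)]]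
    by (intro compact_continuous_image) (auto intro: continuous_on_subset)
  then obtain K where K: "\<And>x. x \<in> {-b..b} \<Longrightarrow> \<bar>(deriv ^^ j) f x\<bar> \<le> K"
    using bounded_iff[THEN iffD1, OF compact_imp_bounded] by (metis image_eqI real_norm_def)
  have "\<bar>(deriv ^^ j) f x\<bar> \<le> max K 0" for x
    using K[of x] 0[of x] by (cases "\<bar>x\<bar> > b") (auto simp: abs_le_iff not_less)
  then show ?thesis by (intro exI[of _ "max K 0"]) auto
qed

lemma smooth_on_suminf:
  fixes F :: "nat \<Rightarrow> real \<Rightarrow> real"
  assumes "\<And>m. smooth_on UNIV (F m)" 
    and "\<And>j. \<exists>N. summable N \<and> (\<forall>m x. \<bar>(deriv ^^ j) (F m) x\<bar> \<le> N m)"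
  shows "smooth_on UNIV (\<lambda>x. \<Sum>m. F m x)"
proof -
  let ?H = "\<lambda>F. (\<forall>m. smooth_on UNIV (F m)) \<and> (\<forall>j. \<exists>N. summable N \<and> (\<forall>m x::real. \<bar>(deriv ^^ j) (F m) x\<bar> \<le> (N m :: real)))"
  show ?thesis
  proof (rule smooth_on_coinduct[where P="\<lambda>f. \<exists>F. ?H F \<and> f = (\<lambda>x. \<Sum>m. F m x)"])
    fix f :: "real \<Rightarrow> real" assume "\<exists>F. ?H F \<and> f = (\<lambda>x. \<Sum>m. F m x)"
    then obtain F where F: "\<And>m. smooth_on UNIV (F m)" 
      "\<And>j. \<exists>N. summable N \<and> (\<forall>m x. \<bar>(deriv ^^ j) (F m) x\<bar> \<le> N m)" and f: "f = (\<lambda>x. \<Sum>m. F m x)" by auto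
    obtain N0 N1 where N0: "summable N0" "\<And>m x. \<bar>F m x\<bar> \<le> N0 m"
      and N1: "summable N1" "\<And>m x. \<bar>deriv (F m) x\<bar> \<le> N1 m"
      using F(2)[of 0] F(2)[of 1] by auto
    have "(f has_real_derivative (\<Sum>m. deriv (F m) x)) (at x)" for x
      unfolding f
    proof (rule has_field_derivative_series'[where S=UNIV and ?x0.0=0])
      show "uniformly_convergent_on UNIV (\<lambda>n x. \<Sum>i<n. deriv (F i) x)"
        by (rule Weierstrass_m_test'[OF _ N1(1)]) (use N1(2) in auto)
      show "summable (\<lambda>n. F n 0)"
        by (rule summable_comparison_test'[OF N0(1)]) (use N0(2) in auto)
    qed (use smooth_on_UNIV_deriv(2)[OF F(1)] in auto)
    moreover have "?H (\<lambda>m. deriv (F m))"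
      using smooth_on_UNIV_deriv(1)[OF F(1)] F(2)[of "Suc _"] by (auto simp del: funpow.simps simp: funpow_Suc_right)
    ultimately show "\<exists>f'. (\<exists>F. ?H F \<and> f' = (\<lambda>x. \<Sum>m. F m x)) \<and> (\<forall>x\<in>UNIV. (f has_vector_derivative f' x) (at x))"
      unfolding has_real_derivative_iff_has_vector_derivative[symmetric]
      by (intro exI[of _ "\<lambda>x. \<Sum>m. deriv (F m) x"] conjI exI[of _ "\<lambda>m. deriv (F m)"]) auto
  qed (use assms in auto)
qed

text \<open>
  Every sequence is the sequence of Taylor coefficients of some smooth function, namely of
  \<open>B 0 x = (\<Sum>k. a k * x ^ k * \<beta> (M k * x))\<close> with a bump function \<open>\<beta>\<close> and factors \<open>M k\<close> that grow fast
  enough. Instead of derivatives at \<open>0\<close> the conclusion records the successive remainders: dropping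
  the first \<open>n\<close> coefficients gives a smooth function \<open>B n\<close>, and near \<open>0\<close>, where the bump function
  equals \<open>1\<close>, consecutive remainders are related as in Horner's scheme. The same \<open>M\<close> must serve all
  the shifted series, which is why \<open>M m\<close> is made to dominate the bounds for all degrees and all
  orders up to \<open>m\<close>.
\<close>

lemma Borel:
  fixes a :: "nat \<Rightarrow> real"
  obtains B :: "nat \<Rightarrow> real \<Rightarrow> real" where "\<And>n. smooth_on UNIV (B n)"
    "\<And>n. \<forall>\<^sub>F x in nhds 0. B n x = a n + x * B (Suc n) x"
proof -
  obtain \<beta> :: "real \<Rightarrow> real" where \<beta>: "smooth_on UNIV \<beta>"
    "\<And>x. \<bar>x\<bar> \<le> 1 \<Longrightarrow> \<beta> x = 1" "\<And>x. \<bar>x\<bar> \<ge> 2 \<Longrightarrow> \<beta> x = 0"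
    using bump_function by blast
  define \<psi> where "\<psi> k y = y ^ k * \<beta> y" for k y
  have \<psi>: "smooth_on UNIV (\<psi> k)" for k
    unfolding \<psi>_def[abs_def] by (intro smooth_on_mult smooth_on_power smooth_on_id \<beta>(1)) auto
  have "\<exists>K\<ge>0. \<forall>x. \<bar>(deriv ^^ j) (\<psi> k) x\<bar> \<le> K" for k j
    by (rule bounded_deriv_funpow[OF \<psi>, of 2]) (use \<beta>(3) in \<open>auto simp: \<psi>_def\<close>)
  then have "\<forall>k. \<exists>K. \<forall>j. K j \<ge> 0 \<and> (\<forall>x. \<bar>(deriv ^^ j) (\<psi> k) x\<bar> \<le> K j)"
    by (intro allI choice) blast
  then obtain K where "\<forall>k j. K k j \<ge> 0 \<and> (\<forall>x. \<bar>(deriv ^^ j) (\<psi> k) x\<bar> \<le> K k j)"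
    using choice[of "\<lambda>k K. \<forall>j. K j \<ge> 0 \<and> (\<forall>x. \<bar>(deriv ^^ j) (\<psi> k) x\<bar> \<le> K j)"] by blast
  then have K: "\<And>k j. K k j \<ge> 0" "\<And>k j x. \<bar>(deriv ^^ j) (\<psi> k) x\<bar> \<le> K k j"
    by blast+
  \<comment> \<open>The summand 1 keeps the factor at least 1; the power of 2 makes the tail geometric.\<close>
  define M where "M m = 1 + 2 ^ m * \<bar>a m\<bar> * (\<Sum>k\<le>m. \<Sum>j\<le>m. K k j)" for m
  have S0: "(\<Sum>k\<le>m. \<Sum>j\<le>m. K k j) \<ge> 0" for m by (intro sum_nonneg K)
  have M1: "M m \<ge> 1" for m using S0[of m] by (simp add: M_def)
  have MK: "\<bar>a m\<bar> * K k j \<le> M m * (1/2) ^ m" if "k \<le> m" "j \<le> m" for k j m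
  proof -
    have "K k j \<le> (\<Sum>j\<le>m. K k j)" using that K(1) by (intro member_le_sum) auto
    also have "\<dots> \<le> (\<Sum>k\<le>m. \<Sum>j\<le>m. K k j)"
      using that K(1) by (intro member_le_sum[of k "{..m}" "\<lambda>k. \<Sum>j\<le>m. K k j"]) (auto intro: sum_nonneg)
    finally have "2 ^ m * \<bar>a m\<bar> * K k j \<le> M m"
      unfolding M_def by (smt (verit) mult_left_mono mult_nonneg_nonneg abs_ge_zero zero_le_power)
    then show ?thesis by (simp add: field_simps power_divide)
  qed
  define T where "T n k x = a (k + n) * x ^ k * \<beta> (M (k + n) * x)" for n k x
  have T: "T n k = (\<lambda>x. (a (k + n) / M (k + n) ^ k) * \<psi> k (M (k + n) * x))" for n k
    using M1[of "k + n"] by (auto simp: T_def \<psi>_def power_mult_distrib field_simps)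
  have Tsmooth: "smooth_on UNIV (T n k)" for n k
    unfolding T
    by (intro smooth_on_mult smooth_on_const smooth_on_compose[OF \<psi>] smooth_on_id) auto
  have bound: "\<bar>(deriv ^^ j) (T n k) x\<bar> \<le> \<bar>a (k + n) / M (k + n) ^ k * M (k + n) ^ j\<bar> * K k j" for n k j x
    unfolding T deriv_funpow_scale[OF \<psi>] abs_mult[of _ "(deriv ^^ j) (\<psi> k) _"]
    by (intro mult_left_mono K) auto
  have small: "\<bar>a (k + n) / M (k + n) ^ k * M (k + n) ^ j\<bar> * K k j \<le> (1/2) ^ k" if "j < k" for n k j
  proof -
    let ?M = "M (k + n)"
    have M: "?M > 0" "?M \<ge> 1" using M1[of "k + n"] by auto
    have "?M * ?M ^ j \<le> ?M ^ k" 
      using power_increasing[of "Suc j" k ?M] that M by simp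
    then have "(\<bar>a (k + n)\<bar> * K k j) * (?M * ?M ^ j) \<le> (\<bar>a (k + n)\<bar> * K k j) * ?M ^ k"
      using K(1)[of k j] by (intro mult_left_mono) auto
    then have "\<bar>a (k + n) / ?M ^ k * ?M ^ j\<bar> * K k j \<le> \<bar>a (k + n)\<bar> * K k j / ?M"
      using M by (simp add: field_simps abs_mult)
    also have "\<dots> \<le> (1/2) ^ (k + n)"
      using MK[of k "k + n" j] that M by (simp add: field_simps)
    also have "\<dots> \<le> (1/2) ^ k" by (intro power_decreasing) auto
    finally show ?thesis .
  qed
  have sm: "summable (\<lambda>k. \<bar>a (k + n) / M (k + n) ^ k * M (k + n) ^ j\<bar> * K k j)" for n j
    by (rule summable_comparison_test'[where g="\<lambda>k. (1/2)^k" and N="Suc j"])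
      (use small K(1) in \<open>auto simp: summable_geometric abs_mult\<close>)
  define B where "B n x = (\<Sum>k. T n k x)" for n x
  show thesis
  proof
    fix n
    show "smooth_on UNIV (B n)"
      unfolding B_def[abs_def] using sm bound Tsmooth by (intro smooth_on_suminf) blast+
    have "B n x = a n + x * B (Suc n) x" if x: "x \<in> {-(1/M n)<..<1/M n}" for x
    proof -
      have s: "summable (\<lambda>k. T n k x)" for n
        by (rule summable_comparison_test'[OF sm[of n 0]]) (use bound[of 0 n] in auto)
      have "B n x = T n 0 x + (\<Sum>k. T n (Suc k) x)"
        unfolding B_def using suminf_split_head[OF s] by simp
      also have "(\<Sum>k. T n (Suc k) x) = x * B (Suc n) x"
        unfolding B_def suminf_mult[OF s, symmetric] by (simp add: T_def mult_ac)
      also have "\<bar>M n * x\<bar> \<le> 1"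
        using x M1[of n] by (auto simp: abs_mult field_simps abs_le_iff)
      then have "T n 0 x = a n" by (simp add: T_def \<beta>(2))
      finally show ?thesis .
    qed
    then show "\<forall>\<^sub>F x in nhds 0. B n x = a n + x * B (Suc n) x"
      unfolding eventually_nhds_0_interval using M1[of n] by (intro exI[of _ "1 / M n"]) auto
  qed
qed

section \<open>Even functions as smooth functions of the square\<close>

text \<open>
  Flatness is stated through divisibility by all powers with smooth quotients, rather than through
  vanishing derivatives, since quotients are what the arguments below produce and consume.
\<close>

definition flat_at_0 :: "(real \<Rightarrow> real) \<Rightarrow> bool" where
  "flat_at_0 r \<longleftrightarrow> (\<forall>n. \<exists>g. smooth_at g 0 \<and> (\<forall>\<^sub>F u in nhds 0. r u = u ^ n * g u))"

lemma continuous_eq_at_0: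
  fixes f g :: "real \<Rightarrow> real"
  assumes "isCont f 0" "isCont g 0" "\<forall>\<^sub>F u in at 0. f u = g u"
  shows "f 0 = g 0"
proof -
  have "(f \<longlongrightarrow> g 0) (at 0)"
    using assms(2) unfolding tendsto_cong[OF assms(3)] by (simp add: isCont_def)
  then show ?thesis using assms(1) LIM_unique by (auto simp: isCont_def)
qed

lemma smooth_on_isCont:
  fixes f :: "real \<Rightarrow> 'b::euclidean_space"
  assumes "smooth_on {-e<..<e} f" "t \<in> {-e<..<e}"
  shows "isCont f t"
  using smooth_on_continuous_on[OF assms(1)] assms(2) by (simp add: continuous_on_eq_continuous_at)

lemma flat_at_0_imp_0:
  assumes "flat_at_0 r" shows "r 0 = 0"
proof -
  obtain g where "\<forall>\<^sub>F u in nhds 0. r u = u ^ 1 * g u" using assms unfolding flat_at_0_def by meson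
  then show ?thesis using eventually_nhds_x_imp_x by fastforce
qed

text \<open>
  The factor \<open>2 * u\<close> is the derivative of \<open>u\<^sup>2\<close>: if \<open>R\<close> satisfies \<open>R (u\<^sup>2) = r u\<close>, then \<open>R'\<close>
  satisfies \<open>R' (u\<^sup>2) = q u\<close>. Thus the lemma says that the class of flat smooth functions is stable
  under the differentiation of \<open>R\<close>.
\<close>

lemma flat_derivative_quotient:
  assumes r: "smooth_on {-e<..<e} r" "flat_at_0 r" and e: "e > 0"
  obtains q where "smooth_on {-e<..<e} q" "flat_at_0 q"
    "\<And>u. u \<in> {-e<..<e} \<Longrightarrow> (r has_real_derivative 2 * u * q u) (at u)"
proof -
  obtain r' where r': "smooth_on {-e<..<e} r'" "\<And>x. x \<in> {-e<..<e} \<Longrightarrow> (r has_vector_derivative r' x) (at x)"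
    using smooth_on_vderivE[OF r(1)] by auto
  have r'_flat: "\<exists>h. smooth_at h 0 \<and> (\<forall>\<^sub>F u in nhds 0. r' u = u ^ Suc n * h u)" for n
  proof -
    obtain g where "smooth_at g 0" and rg: "\<forall>\<^sub>F u in nhds 0. r u = u ^ Suc (Suc n) * g u"
      using r(2) unfolding flat_at_0_def by meson
    then obtain d1 where d1: "d1 > 0" "smooth_on {-d1<..<d1} g" by (elim smooth_at_0_interval)
    from rg obtain d2 where d2: "d2 > 0" "\<forall>u\<in>{-d2<..<d2}. r u = u ^ Suc (Suc n) * g u"
      unfolding eventually_nhds_0_interval by blast
    obtain g' where g': "smooth_on {-d1<..<d1} g'" 
      "\<And>x. x \<in> {-d1<..<d1} \<Longrightarrow> (g has_vector_derivative g' x) (at x)"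
      using smooth_on_vderivE[OF d1(2)] by auto
    define h where "h = (\<lambda>u. real (Suc (Suc n)) * g u + u * g' u)"
    have "smooth_on {-d1<..<d1} h" unfolding h_def
      by (intro smooth_on_add smooth_on_mult smooth_on_const smooth_on_id d1 g') auto
    then have "smooth_at h 0" by (rule smooth_atI) (use d1 in auto)
    moreover have "r' u = u ^ Suc n * h u" if u: "u \<in> {- Min {d1, d2, e}<..<Min {d1, d2, e}}" for u
    proof -
      have "((\<lambda>u. u ^ Suc (Suc n) * g u) has_real_derivative u ^ Suc n * h u) (at u)"
      proof (rule DERIV_cong[OF DERIV_mult[OF DERIV_pow]])
        show "(g has_real_derivative g' u) (at u)"
          unfolding has_real_derivative_iff_has_vector_derivative by (rule g'(2)) (use u in auto)
      qed (simp add: h_def algebra_simps)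
      then have "(r has_real_derivative u ^ Suc n * h u) (at u)"
        by (rule has_field_derivative_transform_within_open[where S="{-d2<..<d2}"]) (use u d2 in auto)
      moreover have "(r has_real_derivative r' u) (at u)"
        unfolding has_real_derivative_iff_has_vector_derivative by (rule r'(2)) (use u in auto)
      ultimately show ?thesis by (rule DERIV_unique[rotated])
    qed
    then have "\<forall>\<^sub>F u in nhds 0. r' u = u ^ Suc n * h u"
      unfolding eventually_nhds_0_interval using d1 d2 e by (intro exI[of _ "Min {d1, d2, e}"]) auto
    ultimately show ?thesis by blast
  qed
  have "r' 0 = 0"
    using r'_flat[of 0] eventually_nhds_x_imp_x by fastforce
  obtain q where q: "smooth_on {-e<..<e} q" "\<And>u. u \<in> {-e<..<e} \<Longrightarrow> r' u = r' 0 + u *\<^sub>R q u"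
    using Hadamard[OF r'(1)] by blast
  have "\<exists>g. smooth_at g 0 \<and> (\<forall>\<^sub>F u in nhds 0. q u / 2 = u ^ n * g u)" for n
  proof -
    obtain h where h: "smooth_at h 0" "\<forall>\<^sub>F u in nhds 0. r' u = u ^ Suc n * h u"
      using r'_flat by blast
    then obtain d1 where d1: "d1 > 0" "smooth_on {-d1<..<d1} h" by (elim smooth_at_0_interval)
    from h obtain d2 where d2: "d2 > 0" "\<forall>u\<in>{-d2<..<d2}. r' u = u ^ Suc n * h u"
      unfolding eventually_nhds_0_interval by blast
    define d where "d = Min {d1, d2, e}"
    have d: "d > 0" using d1 d2 e by (simp add: d_def)
    have off: "q u = u ^ n * h u" if "u \<in> {-d<..<d}" "u \<noteq> 0" for u
    proof -
      have u: "u \<in> {-d2<..<d2}" "u \<in> {-e<..<e}" using that by (auto simp: d_def)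
      have "u * q u = u * (u ^ n * h u)"
        using bspec[OF d2(2) u(1)] q(2)[OF u(2)] \<open>r' 0 = 0\<close> by (simp add: mult.assoc)
      then show ?thesis using \<open>u \<noteq> 0\<close> by simp
    qed
    have "q 0 = 0 ^ n * h 0"
    proof (rule continuous_eq_at_0[of q "\<lambda>u. u ^ n * h u"])
      show "isCont q 0" using smooth_on_isCont[OF q(1)] e by simp
      show "isCont (\<lambda>u. u ^ n * h u) 0" 
        using smooth_on_isCont[OF d1(2)] d1(1) by (intro continuous_intros) auto
      show "\<forall>\<^sub>F u in at 0. q u = u ^ n * h u"
        unfolding eventually_at_filter eventually_nhds_0_interval using d off by blast
    qed
    with off have "q u = u ^ n * h u" if "u \<in> {-d<..<d}" for u using that by (cases "u = 0") auto
    then have "\<forall>\<^sub>F u in nhds 0. q u / 2 = u ^ n * (h u / 2)"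
      unfolding eventually_nhds_0_interval using d by (intro exI[of _ d]) auto
    moreover have "smooth_at (\<lambda>u. h u / 2) 0"
      by (rule smooth_atI[of "{-d1<..<d1}"], rule smooth_on_divide) (use d1 in \<open>auto intro: smooth_on_const\<close>)
    ultimately show ?thesis by blast
  qed
  then have "flat_at_0 (\<lambda>u. q u / 2)" by (simp add: flat_at_0_def)
  moreover have "smooth_on {-e<..<e} (\<lambda>u. q u / 2)"
    by (rule smooth_on_divide) (use q in \<open>auto intro: smooth_on_const\<close>)
  moreover have "(r has_real_derivative 2 * u * (q u / 2)) (at u)" if "u \<in> {-e<..<e}" for u
    using r'(2)[OF that] q(2)[OF that] \<open>r' 0 = 0\<close> by (simp add: has_real_derivative_iff_has_vector_derivative)
  ultimately show thesis using that by blast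
qed

text \<open>
  By the preceding lemma, composing flat functions with the square root and extending by zero
  gives a class that is closed under differentiation. At \<open>x = 0\<close> the difference quotient tends to
  zero, because \<open>r u\<close> is divisible by \<open>u ^ 4\<close> and so \<open>r (sqrt x)\<close> is divisible by \<open>x\<^sup>2\<close>.
\<close>

lemma smooth_on_flat_sqrt:
  assumes "smooth_on {-e<..<e} r" "flat_at_0 r" and e: "e > 0"
  shows "smooth_on {..<e\<^sup>2} (\<lambda>x. if x > 0 then r (sqrt x) else 0)"
proof -
  let ?R = "\<lambda>r x. if x > 0 then r (sqrt x) else (0::real)"
  have key: "(?R r has_real_derivative ?R q x) (at x)"
    if r: "smooth_on {-e<..<e} r" "flat_at_0 r"
      and q: "\<And>u. u \<in> {-e<..<e} \<Longrightarrow> (r has_real_derivative 2 * u * q u) (at u)" and x: "x < e\<^sup>2" for r q x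
  proof -
    consider "x > 0" | "x < 0" | "x = 0" by linarith
    then show ?thesis
    proof cases
      case 1
      have "sqrt x < e" using x 1 e by (simp add: real_less_lsqrt)
      moreover have "sqrt x > 0" using 1 by simp
      moreover from this have "- e < sqrt x" using e by linarith
      ultimately have "sqrt x \<in> {-e<..<e}" by simp
      from DERIV_chain2[OF q[OF this] DERIV_real_sqrt[OF 1]] \<open>sqrt x > 0\<close>
      have "((\<lambda>x. r (sqrt x)) has_real_derivative q (sqrt x)) (at x)" 
        by (simp add: field_simps)
      then have "(?R r has_real_derivative q (sqrt x)) (at x)"
        by (rule has_field_derivative_transform_within_open[where S="{0<..}"]) (use 1 in auto)
      then show ?thesis using 1 by simp
    next
      case 2
      have "((\<lambda>x. 0) has_real_derivative 0) (at x)" by simp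
      then have "(?R r has_real_derivative 0) (at x)"
        by (rule has_field_derivative_transform_within_open[where S="{..<0}"]) (use 2 in auto)
      then show ?thesis using 2 by simp
    next
      case 3
      \<comment> \<open>At the origin \<open>r (sqrt h) / h = h * g (sqrt h)\<close> for \<open>h > 0\<close>.\<close>
      obtain g where g: "smooth_at g 0" "\<forall>\<^sub>F u in nhds 0. r u = u ^ 4 * g u"
        using r(2) unfolding flat_at_0_def by meson
      then obtain d1 where d1: "d1 > 0" "smooth_on {-d1<..<d1} g" by (elim smooth_at_0_interval)
      from g obtain d2 where d2: "d2 > 0" "\<forall>u\<in>{-d2<..<d2}. r u = u ^ 4 * g u"
        unfolding eventually_nhds_0_interval by blast
      define d where "d = min d1 d2"
      have "isCont g 0" using smooth_on_isCont[OF d1(2)] d1(1) by simp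
      moreover have "isCont (\<lambda>h. sqrt \<bar>h\<bar>) 0" by (intro continuous_intros)
      ultimately have "isCont (\<lambda>h. h * g (sqrt \<bar>h\<bar>)) 0"
        by (intro continuous_intros isCont_o2[where f="\<lambda>h. sqrt \<bar>h\<bar>"]) auto
      then have lim: "((\<lambda>h. h * g (sqrt \<bar>h\<bar>)) \<longlongrightarrow> 0) (at 0)"
        by (simp add: isCont_def)
      have "((\<lambda>h. (?R r (0 + h) - ?R r 0) / h) \<longlongrightarrow> 0) (at 0)"
      proof (rule Lim_null_comparison[OF _ tendsto_rabs_zero[OF lim]])
        have "norm ((?R r (0 + h) - ?R r 0) / h) \<le> \<bar>h * g (sqrt \<bar>h\<bar>)\<bar>" if h: "h \<in> {-(d\<^sup>2)<..<d\<^sup>2}" for h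
        proof (cases "h > 0")
          case True
          have "sqrt h < d" using h True d1 d2 by (intro real_less_lsqrt) (auto simp: d_def)
          moreover have "- d2 < sqrt h" using real_sqrt_gt_zero[OF True] d2(1) by linarith
          ultimately have "sqrt h \<in> {-d2<..<d2}" by (simp add: d_def)
          then have "r (sqrt h) = sqrt h ^ 4 * g (sqrt h)"
            by (rule bspec[OF d2(2)])
          moreover have "sqrt h ^ 4 = h * h"
            using True by (simp add: power4_eq_xxxx)
          ultimately show ?thesis using True by (simp add: abs_mult)
        qed simp
        then show "\<forall>\<^sub>F h in at 0. norm ((?R r (0 + h) - ?R r 0) / h) \<le> \<bar>h * g (sqrt \<bar>h\<bar>)\<bar>"
          unfolding eventually_at_filter eventually_nhds_0_interval
          using d1 d2 by (intro exI[of _ "d\<^sup>2"]) (auto simp: d_def)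
      qed
      then show ?thesis unfolding 3 DERIV_def by simp
    qed
  qed
  show ?thesis
  proof (rule smooth_on_coinduct[where P="\<lambda>f. \<exists>r. smooth_on {-e<..<e} r \<and> flat_at_0 r \<and> f = ?R r"])
    fix f assume "\<exists>r. smooth_on {-e<..<e} r \<and> flat_at_0 r \<and> f = ?R r"
    then obtain r where r: "smooth_on {-e<..<e} r" "flat_at_0 r" "f = ?R r" by blast
    obtain q where q: "smooth_on {-e<..<e} q" "flat_at_0 q"
      "\<And>u. u \<in> {-e<..<e} \<Longrightarrow> (r has_real_derivative 2 * u * q u) (at u)"
      using flat_derivative_quotient[OF r(1,2) e] by blast
    show "\<exists>f'. (\<exists>r. smooth_on {-e<..<e} r \<and> flat_at_0 r \<and> f' = ?R r) \<and> (\<forall>x\<in>{..<e\<^sup>2}. (f has_vector_derivative f' x) (at x))"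
      using q key[OF r(1,2) q(3)] r(3)
      by (intro exI[of _ "?R q"] conjI exI[of _ q]) (auto simp: has_real_derivative_iff_has_vector_derivative)
  qed (use assms in auto)
qed

lemma smooth_on_reflect:
  "smooth_on {-e<..<e} f \<Longrightarrow> smooth_on {-e<..<e::real} (\<lambda>u. f (- u))"
  by (rule smooth_on_compose[where T="{-e<..<e}"]) (auto intro: smooth_on_minus[OF _ smooth_on_id])

text \<open>
  The quotient supplied by Hadamard's lemma is replaced by its even part, which serves as well
  because \<open>f\<close> is odd.
\<close>

lemma odd_quotient:
  fixes f :: "real \<Rightarrow> real"
  assumes f: "smooth_on {-e<..<e} f" and odd: "\<And>u. u \<in> {-e<..<e} \<Longrightarrow> f (- u) = - f u"
  obtains g where "smooth_on {-e<..<e} g" "\<And>u. g (- u) = g u" "\<And>u. u \<in> {-e<..<e} \<Longrightarrow> f u = u * g u"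
proof -
  obtain k where k: "smooth_on {-e<..<e} k" "\<And>u. u \<in> {-e<..<e} \<Longrightarrow> f u = f 0 + u *\<^sub>R k u"
    using Hadamard[OF f] by blast
  show thesis
  proof
    show "smooth_on {-e<..<e} (\<lambda>u. (k u + k (- u)) / 2)"
      by (rule smooth_on_divide[OF _ smooth_on_add[OF _ k(1) smooth_on_reflect[OF k(1)]] smooth_on_const]) auto
    show "f u = u * ((k u + k (- u)) / 2)" if u: "u \<in> {-e<..<e}" for u
      using k(2)[OF u] k(2)[of "- u"] odd[OF u] u by (simp add: field_simps)
  qed (simp add: add.commute)
qed

lemma even_quotient:
  fixes f :: "real \<Rightarrow> real"
  assumes f: "smooth_on {-e<..<e} f" and even: "\<And>u. u \<in> {-e<..<e} \<Longrightarrow> f (- u) = f u"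
  obtains g where "smooth_on {-e<..<e} g" "\<And>u. g (- u) = g u" "\<And>u. u \<in> {-e<..<e} \<Longrightarrow> f u = f 0 + u\<^sup>2 * g u"
proof -
  obtain k where k: "smooth_on {-e<..<e} k" "\<And>u. u \<in> {-e<..<e} \<Longrightarrow> f u = f 0 + u *\<^sub>R k u"
    using Hadamard[OF f] by blast
  \<comment> \<open>The odd part of the Hadamard quotient serves as well, and it can be divided by \<open>u\<close> again.\<close>
  define k1 where "k1 = (\<lambda>u. (k u - k (- u)) / 2)"
  have k1: "smooth_on {-e<..<e} k1" unfolding k1_def
    by (rule smooth_on_divide[OF _ smooth_on_diff[OF _ k(1) smooth_on_reflect[OF k(1)]] smooth_on_const]) auto
  have fk1: "f u = f 0 + u * k1 u" if u: "u \<in> {-e<..<e}" for u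
    using k(2)[OF u] k(2)[of "- u"] even[OF u] u by (simp add: field_simps k1_def)
  have k1_odd: "k1 (- u) = - k1 u" for u by (simp add: k1_def field_simps)
  obtain g where g: "smooth_on {-e<..<e} g" "\<And>u. g (- u) = g u" "\<And>u. u \<in> {-e<..<e} \<Longrightarrow> k1 u = u * g u"
    using odd_quotient[OF k1 k1_odd] by blast
  show thesis
  proof (rule that[OF g(1,2)])
    show "f u = f 0 + u\<^sup>2 * g u" if "u \<in> {-e<..<e}" for u
      using fk1[OF that] g(3)[OF that] by (simp add: power2_eq_square)
  qed
qed

text \<open>
  Repeated division by \<open>u\<^sup>2\<close> produces even smooth functions \<open>G n\<close> with
  \<open>G n u = G n 0 + u\<^sup>2 * G (Suc n) u\<close>. Borel's theorem, applied to the sequence \<open>G n 0\<close>, gives a smooth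
  \<open>B 0\<close> such that \<open>f u - B 0 (u\<^sup>2)\<close> is flat. The flat part is a smooth function of \<open>u\<^sup>2\<close> by
  \<open>smooth_on_flat_sqrt\<close>. The value of \<open>h\<close> at negative arguments matters: it makes \<open>h\<close> smooth in a full
  neighbourhood of \<open>0\<close>, as a coordinate change of the plane requires.
\<close>

lemma Whitney_even:
  fixes f :: "real \<Rightarrow> real"
  assumes f: "smooth_on {-e<..<e} f" and even: "\<And>u. u \<in> {-e<..<e} \<Longrightarrow> f (- u) = f u" and e: "e > 0"
  obtains h where "smooth_on {..<e\<^sup>2} h" "\<And>u. u \<in> {-e<..<e} \<Longrightarrow> f u = h (u\<^sup>2)"
proof -
  let ?E = "\<lambda>f::real \<Rightarrow> real. smooth_on {-e<..<e} f \<and> (\<forall>u\<in>{-e<..<e}. f (- u) = f u)"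
  have "\<exists>G. \<forall>n. (?E (G n) \<and> (n = 0 \<longrightarrow> G n = f)) \<and> (\<forall>u\<in>{-e<..<e}. G n u = G n 0 + u\<^sup>2 * G (Suc n) u)"
  proof (rule dependent_nat_choice[where P="\<lambda>n g. ?E g \<and> (n = 0 \<longrightarrow> g = f)"
        and Q="\<lambda>n g k. \<forall>u\<in>{-e<..<e}. g u = g 0 + u\<^sup>2 * k u"])
    show "\<exists>g. ?E g \<and> ((0::nat) = 0 \<longrightarrow> g = f)" using f even by blast
  next
    fix g :: "real \<Rightarrow> real" and n :: nat assume "?E g \<and> (n = 0 \<longrightarrow> g = f)"
    then obtain k where "smooth_on {-e<..<e} k" "\<And>u. k (- u) = k u" "\<And>u. u \<in> {-e<..<e} \<Longrightarrow> g u = g 0 + u\<^sup>2 * k u"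
      using even_quotient[of e g] by blast
    then show "\<exists>k. (?E k \<and> (Suc n = 0 \<longrightarrow> k = f)) \<and> (\<forall>u\<in>{-e<..<e}. g u = g 0 + u\<^sup>2 * k u)" by blast
  qed
  then obtain G where G: "\<And>n. smooth_on {-e<..<e} (G n)"
    "\<And>n u. u \<in> {-e<..<e} \<Longrightarrow> G n u = G n 0 + u\<^sup>2 * G (Suc n) u" "G 0 = f" by blast
  obtain B where B: "\<And>n. smooth_on UNIV (B n)" "\<And>n. \<forall>\<^sub>F x in nhds 0. B n x = G n 0 + x * B (Suc n) x"
    using Borel[of "\<lambda>n. G n 0"] by blast
  define r where "r n u = G n u - B n (u\<^sup>2)" for n u
  have r: "smooth_on {-e<..<e} (r n)" for n
    unfolding r_def[abs_def]
    by (rule smooth_on_diff[OF _ G(1) smooth_on_compose[OF B(1)]]) (auto intro: smooth_on_power[OF _ smooth_on_id])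
  have step: "\<forall>\<^sub>F u in nhds 0. r n u = u\<^sup>2 * r (Suc n) u" for n
  proof -
    have "filterlim (\<lambda>u::real. u\<^sup>2) (nhds 0) (nhds 0)"
      using isCont_power[OF continuous_ident, of 0 2] by (simp add: isCont_def tendsto_nhds_iff)
    then have "\<forall>\<^sub>F u in nhds 0. B n (u\<^sup>2) = G n 0 + u\<^sup>2 * B (Suc n) (u\<^sup>2)"
      using B(2) by (rule eventually_compose_filterlim[rotated])
    moreover have "\<forall>\<^sub>F u in nhds 0. u \<in> {-e<..<e}"
      unfolding eventually_nhds_0_interval by (intro exI[of _ e] conjI e) simp
    ultimately show ?thesis
    proof eventually_elim
      case (elim u)
      show ?case
        unfolding r_def elim(1) G(2)[OF elim(2), of n] by (simp add: algebra_simps)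
    qed
  qed
  have pow: "\<forall>\<^sub>F u in nhds 0. r 0 u = u ^ (2 * n) * r n u" for n
  proof (induction n)
    case (Suc n)
    from Suc step[of n] show ?case by eventually_elim (simp add: power2_eq_square mult_ac)
  qed simp
  have "flat_at_0 (r 0)"
    unfolding flat_at_0_def
  proof
    fix n
    have "\<forall>\<^sub>F u in nhds 0. r 0 u = u ^ n * (u ^ n * r n u)"
      using pow[of n] by eventually_elim (simp add: mult_2 power_add)
    moreover have "smooth_at (\<lambda>u. u ^ n * r n u) 0"
      by (rule smooth_atI[of "{-e<..<e}"], rule smooth_on_mult)
        (use e r in \<open>auto intro: smooth_on_power[OF _ smooth_on_id]\<close>)
    ultimately show "\<exists>g. smooth_at g 0 \<and> (\<forall>\<^sub>F u in nhds 0. r 0 u = u ^ n * g u)" by blast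
  qed
  then have R: "smooth_on {..<e\<^sup>2} (\<lambda>x. if x > 0 then r 0 (sqrt x) else 0)" and "r 0 0 = 0"
    using smooth_on_flat_sqrt[OF r _ e] flat_at_0_imp_0 by auto
  show thesis
  proof
    show "smooth_on {..<e\<^sup>2} (\<lambda>x. B 0 x + (if x > 0 then r 0 (sqrt x) else 0))"
      by (rule smooth_on_add[OF _ smooth_on_subset[OF B(1)] R]) auto
    fix u assume u: "u \<in> {-e<..<e}"
    then have "f \<bar>u\<bar> = f u" using even[of u] by (cases "u \<ge> 0") auto
    then show "f u = B 0 (u\<^sup>2) + (if u\<^sup>2 > 0 then r 0 (sqrt (u\<^sup>2)) else 0)"
      using \<open>r 0 0 = 0\<close> G(3) by (cases "u = 0") (auto simp: r_def)
  qed
qed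

lemma even_odd_decomposition:
  fixes c :: "real \<Rightarrow> real"
  assumes c: "smooth_on {-e<..<e} c" and e: "e > 0"
  obtains p q where "smooth_on {..<e\<^sup>2} p" "smooth_on {..<e\<^sup>2} q" 
    "\<And>u. u \<in> {-e<..<e} \<Longrightarrow> c u = p (u\<^sup>2) + u * q (u\<^sup>2)"
proof -
  have "smooth_on {-e<..<e} (\<lambda>u. (c u + c (- u)) / 2)" "smooth_on {-e<..<e} (\<lambda>u. (c u - c (- u)) / 2)"
    by (rule smooth_on_divide[OF _ smooth_on_add[OF _ c smooth_on_reflect[OF c]] smooth_on_const]
         smooth_on_divide[OF _ smooth_on_diff[OF _ c smooth_on_reflect[OF c]] smooth_on_const]; simp)+
  note smooth = this
  have even: "(c (- u) + c (- (- u))) / 2 = (c u + c (- u)) / 2"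
    and odd: "(c (- u) - c (- (- u))) / 2 = - ((c u - c (- u)) / 2)" for u
    by (simp_all add: field_simps)
  obtain p where p: "smooth_on {..<e\<^sup>2} p" "\<And>u. u \<in> {-e<..<e} \<Longrightarrow> (c u + c (- u)) / 2 = p (u\<^sup>2)"
    using Whitney_even[OF smooth(1) even e] by blast
  obtain g where g: "smooth_on {-e<..<e} g" "\<And>u. g (- u) = g u"
    "\<And>u. u \<in> {-e<..<e} \<Longrightarrow> (c u - c (- u)) / 2 = u * g u"
    using odd_quotient[OF smooth(2) odd] by blast
  obtain q where q: "smooth_on {..<e\<^sup>2} q" "\<And>u. u \<in> {-e<..<e} \<Longrightarrow> g u = q (u\<^sup>2)"
    using Whitney_even[OF g(1) g(2) e] by blast
  show thesis
  proof (rule that[OF p(1) q(1)])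
    fix u assume u: "u \<in> {-e<..<e}"
    have "c u = (c u + c (- u)) / 2 + (c u - c (- u)) / 2" by (simp add: field_simps)
    then show "c u = p (u\<^sup>2) + u * q (u\<^sup>2)" using p(2)[OF u] g(3)[OF u] q(2)[OF u] by simp
  qed
qed

section \<open>A criterion for cusps\<close>

lemma vector_2_eq: "(vector [a, b] :: real^2) = a *\<^sub>R axis 1 1 + b *\<^sub>R axis 2 1"
  by (simp add: vec_eq_iff forall_2 axis_def)

lemma smooth_on_vector_2:
  "open S \<Longrightarrow> smooth_on S p \<Longrightarrow> smooth_on S q \<Longrightarrow> smooth_on S (\<lambda>x. vector [p x, q x] :: real^2)"
  unfolding vector_2_eq by (intro smooth_on_add smooth_on_scaleR smooth_on_const)

lemma smooth_on_nth: "open S \<Longrightarrow> smooth_on S f \<Longrightarrow> smooth_on S (\<lambda>x. (f x :: real^2) $ i)"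
  by (rule smooth_on_linear_compose[OF bounded_linear_vec_nth])

lemma smooth_on_bracket:
  "open S \<Longrightarrow> smooth_on S f \<Longrightarrow> smooth_on S g \<Longrightarrow> smooth_on S (\<lambda>x. bracket (f x) (g x))"
  unfolding bracket_def by (intro smooth_on_diff smooth_on_mult smooth_on_nth)

lemma ident_scaleR_derivative:
  fixes g :: "real \<Rightarrow> 'b::euclidean_space"
  assumes g: "smooth_on {-e<..<e} g" and e: "e > 0"
  shows "((\<lambda>t. t *\<^sub>R g t) has_vector_derivative g 0) (at 0)"
proof -
  obtain g' where "\<And>x. x \<in> {-e<..<e} \<Longrightarrow> (g has_vector_derivative g' x) (at x)"
    using smooth_on_vderivE[OF g] by auto
  then have "(g has_vector_derivative g' 0) (at 0)" using e by simp
  from has_vector_derivative_scaleR[OF DERIV_ident this] show ?thesis by simp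
qed

lemma positive_interval:
  fixes f :: "real \<Rightarrow> real"
  assumes "smooth_on {-e<..<e} f" "e > 0" "f 0 > 0"
  obtains d where "0 < d" "d \<le> e" "\<And>t. t \<in> {-d<..<d} \<Longrightarrow> f t > 0"
proof -
  have "(f \<longlongrightarrow> f 0) (nhds 0)"
    using smooth_on_isCont[OF assms(1), of 0] assms(2) by (simp add: isCont_def tendsto_nhds_iff)
  then have "\<forall>\<^sub>F t in nhds 0. f t > 0" using assms(3) by (rule order_tendstoD(1))
  then obtain d where d: "d > 0" "\<forall>t\<in>{-d<..<d}. f t > 0"
    unfolding eventually_nhds_0_interval by blast
  show thesis
  proof (rule that[of "min d e"])
    fix t assume "t \<in> {-min d e<..<min d e}"
    then have "t \<in> {-d<..<d}" by auto
    then show "f t > 0" using d(2) by blast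
  qed (use d assms in auto)
qed

lemma open_0_interval:
  assumes "open S" "(0::real) \<in> S"
  obtains d where "d > 0" "{-d<..<d} \<subseteq> S"
  using eventually_nhds_in_open[OF assms] unfolding eventually_nhds_0_interval by blast

lemma diffeomorphismD:
  assumes "diffeomorphism U V f g"
  shows "open U" "open V" "smooth_on U f" "smooth_on V g"
    "\<And>x. x \<in> U \<Longrightarrow> f x \<in> V" "\<And>y. y \<in> V \<Longrightarrow> g y \<in> U"
    "\<And>x. x \<in> U \<Longrightarrow> g (f x) = x" "\<And>y. y \<in> V \<Longrightarrow> f (g y) = y"
  using assms unfolding diffeomorphism_def homeomorphism_def by blast+

lemma diffeomorphismI:
  assumes "open U" "open V" "smooth_on U f" "smooth_on V g"
    "\<And>x. x \<in> U \<Longrightarrow> f x \<in> V" "\<And>y. y \<in> V \<Longrightarrow> g y \<in> U"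
    "\<And>x. x \<in> U \<Longrightarrow> g (f x) = x" "\<And>y. y \<in> V \<Longrightarrow> f (g y) = y"
  shows "diffeomorphism U V f g"
proof -
  have "homeomorphism U V f g"
    by (rule homeomorphismI) (use assms smooth_on_continuous_on in \<open>blast+\<close>)
  with assms show ?thesis by (simp add: diffeomorphism_def)
qed

lemma local_diffeo_atI: "diffeomorphism U V f g \<Longrightarrow> x \<in> U \<Longrightarrow> local_diffeo_at f x"
  unfolding local_diffeo_at_def by blast

lemma diffeomorphism_cong:
  assumes "diffeomorphism U V f g" "\<And>x. x \<in> U \<Longrightarrow> f x = f' x"
  shows "diffeomorphism U V f' g"
  using diffeomorphismD[OF assms(1)] assms(2)
  by (intro diffeomorphismI smooth_on_cong_imp[OF diffeomorphismD(3)[OF assms(1)]]) auto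

text \<open>
  The new parameter \<open>u = t * sqrt (a t)\<close> makes the first coordinate equal to \<open>u\<^sup>2\<close> and the second
  equal to \<open>u ^ 3 * c u\<close> with \<open>c 0 \<noteq> 0\<close>. By Whitney's theorem \<open>c u = p (u\<^sup>2) + u * q (u\<^sup>2)\<close>, so the
  second coordinate is \<open>u ^ 3 * p (u\<^sup>2) + (u\<^sup>2)\<^sup>2 * q (u\<^sup>2)\<close>. Hence
  \<open>(x, y) \<mapsto> (x, y * p x + x\<^sup>2 * q x)\<close> carries the curve \<open>(u\<^sup>2, u ^ 3)\<close> to the given one, and it is
  invertible where \<open>p\<close> does not vanish.
\<close>

lemma cusp_3_2_normal_form:
  assumes e: "e > 0" and a: "smooth_on {-e<..<e} a" "a 0 > 0" and b: "smooth_on {-e<..<e} b" "b 0 \<noteq> 0"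
    and \<gamma>: "\<And>t. t \<in> {-e<..<e} \<Longrightarrow> \<gamma> t = vector [t\<^sup>2 * a t, t^3 * b t]"
  shows "cusp_3_2 \<gamma> 0"
proof -
  have "\<gamma> 0 = 0" using \<gamma>[of 0] e by (simp add: vec_eq_iff forall_2)
  have singular: "singular_point \<gamma> 0"
  proof -
    let ?g = "\<lambda>t. vector [t * a t, t\<^sup>2 * b t] :: real^2"
    have "smooth_on {-e<..<e} ?g"
      by (intro smooth_on_vector_2 smooth_on_mult smooth_on_power[OF _ smooth_on_id] smooth_on_id a b) auto
    from ident_scaleR_derivative[OF this e]
    have "((\<lambda>t. t *\<^sub>R ?g t) has_vector_derivative 0) (at 0)"
      by (simp add: vector_2_eq)
    then have "(\<gamma> has_vector_derivative 0) (at 0)"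
      by (rule has_vector_derivative_transform_within_open[where S="{-e<..<e}"])
        (use e \<gamma> in \<open>auto simp: vec_eq_iff forall_2 power2_eq_square power3_eq_cube\<close>)
    then show ?thesis by (simp add: singular_point_def nth_deriv_def vector_derivative_at)
  qed
  obtain d where d: "0 < d" "d \<le> e" and apos: "\<And>t. t \<in> {-d<..<d} \<Longrightarrow> a t > 0"
    using positive_interval[OF a(1) e a(2)] by blast
  have sub: "{-d<..<d} \<subseteq> {-e<..<e}" using d by auto
  define U where "U = (\<lambda>t. t * sqrt (a t))"
  have sa: "smooth_on {-d<..<d} (\<lambda>t. sqrt (a t))"
    by (rule smooth_on_sqrt[OF smooth_on_subset[OF a(1) sub] _ apos]) auto
  have "smooth_on {-d<..<d} U" unfolding U_def
    by (rule smooth_on_mult[OF _ smooth_on_id sa]) auto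
  moreover have "(U has_real_derivative sqrt (a 0)) (at 0)"
    using ident_scaleR_derivative[OF sa d(1)] by (simp add: U_def has_real_derivative_iff_has_vector_derivative)
  ultimately obtain d1 \<phi> where d1: "0 < d1" "d1 \<le> d" 
    and diff: "diffeomorphism {-d1<..<d1} (U ` {-d1<..<d1}) U \<phi>"
    using inverse_function_1d[of d U "sqrt (a 0)"] d(1) a(2) by auto
  let ?V = "U ` {-d1<..<d1}"
  note U\<phi> = diffeomorphismD[OF diff]
  have "U 0 = 0" by (simp add: U_def)
  then have "0 \<in> ?V" "\<phi> 0 = 0" using U\<phi>(5)[of 0] U\<phi>(7)[of 0] d1(1) by auto
  obtain e2 where e2: "e2 > 0" "{-e2<..<e2} \<subseteq> ?V" using open_0_interval[OF U\<phi>(2) \<open>0 \<in> ?V\<close>] by blast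
  have \<phi>d: "\<phi> u \<in> {-d<..<d}" if "u \<in> {-e2<..<e2}" for u
    using U\<phi>(6)[of u] that e2 d1(2) by fastforce
  have \<phi>: "smooth_on {-e2<..<e2} \<phi>" using smooth_on_subset[OF U\<phi>(4) e2(2)] .
  define s where "s u = sqrt (a (\<phi> u))" for u
  have spos: "s u > 0" if "u \<in> {-e2<..<e2}" for u using apos[OF \<phi>d[OF that]] by (simp add: s_def)
  have u_eq: "\<phi> u * s u = u" if "u \<in> {-e2<..<e2}" for u
    using U\<phi>(8)[of u] that e2(2) by (auto simp: U_def s_def)
  \<comment> \<open>Since \<open>\<phi> u = u / s u\<close>, the second coordinate \<open>\<phi> u ^ 3 * b (\<phi> u)\<close> is \<open>u ^ 3 * c u\<close>.\<close>
  define c where "c u = b (\<phi> u) / s u ^ 3" for u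
  have s: "smooth_on {-e2<..<e2} s"
    unfolding s_def[abs_def] by (rule smooth_on_compose[OF sa _ _ _ \<phi>]) (use \<phi>d in auto)
  have b\<phi>: "smooth_on {-e2<..<e2} (\<lambda>u. b (\<phi> u))"
    by (rule smooth_on_compose[OF b(1) _ _ _ \<phi>]) (use \<phi>d sub in auto)
  have c: "smooth_on {-e2<..<e2} c"
    unfolding c_def[abs_def]
    by (rule smooth_on_divide[OF _ b\<phi> smooth_on_power[OF _ s]]) (use spos in force)+
  have "c 0 \<noteq> 0" using b(2) spos[of 0] e2(1) \<open>\<phi> 0 = 0\<close> by (simp add: c_def)
  obtain p q where p: "smooth_on {..<e2\<^sup>2} p" and q: "smooth_on {..<e2\<^sup>2} q"
    and cpq: "\<And>u. u \<in> {-e2<..<e2} \<Longrightarrow> c u = p (u\<^sup>2) + u * q (u\<^sup>2)"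
    using even_odd_decomposition[OF c e2(1)] by blast
  have "p 0 = c 0" using cpq[of 0] e2(1) by simp
  have subp: "{-(e2\<^sup>2)<..<e2\<^sup>2} \<subseteq> {..<e2\<^sup>2}" by auto
  \<comment> \<open>The square of \<open>p\<close> is positive at \<open>0\<close> whatever the sign of \<open>p 0\<close>.\<close>
  have "smooth_on {-(e2\<^sup>2)<..<e2\<^sup>2} (\<lambda>x. p x * p x)"
    by (rule smooth_on_mult) (use smooth_on_subset[OF p subp] in auto)
  then obtain d3 where d3: "0 < d3" "d3 \<le> e2\<^sup>2" "\<And>x. x \<in> {-d3<..<d3} \<Longrightarrow> p x * p x > 0"
    by (rule positive_interval) (use e2(1) \<open>p 0 = c 0\<close> \<open>c 0 \<noteq> 0\<close> in \<open>auto simp: zero_less_mult_iff neq_iff\<close>)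
  then have pnz: "p x \<noteq> 0" if "x \<in> {-d3<..<d3}" for x using that by fastforce
  define W where "W = {x::real^2. x $ 1 \<in> {-d3<..<d3}}"
  define \<Phi> where "\<Phi> x = (vector [x $ 1, (x $ 2 - (x $ 1)\<^sup>2 * q (x $ 1)) / p (x $ 1)] :: real^2)" for x :: "real^2"
  define \<Psi> where "\<Psi> x = (vector [x $ 1, x $ 2 * p (x $ 1) + (x $ 1)\<^sup>2 * q (x $ 1)] :: real^2)" for x :: "real^2"
  have W: "open W" unfolding W_def greaterThanLessThan_iff
    by (intro open_Collect_conj open_Collect_less continuous_intros)
  have coord: "smooth_on W (\<lambda>x. x $ i)" for i by (rule smooth_on_nth[OF W smooth_on_id[OF W]])
  have pW: "smooth_on W (\<lambda>x. p (x $ 1))" and qW: "smooth_on W (\<lambda>x. q (x $ 1))"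
    by (rule smooth_on_compose[OF p _ W _ coord] smooth_on_compose[OF q _ W _ coord]; use d3 in \<open>force simp: W_def\<close>)+
  have "smooth_on W \<Phi>" unfolding \<Phi>_def[abs_def]
    by (intro smooth_on_vector_2 smooth_on_divide smooth_on_diff smooth_on_mult smooth_on_power W coord pW qW)
      (use pnz in \<open>auto simp: W_def\<close>)
  moreover have "smooth_on W \<Psi>" unfolding \<Psi>_def[abs_def]
    by (intro smooth_on_vector_2 smooth_on_add smooth_on_mult smooth_on_power W coord pW qW)
  ultimately have "diffeomorphism W W \<Phi> \<Psi>"
    by (rule diffeomorphismI[OF W W]) 
      (use pnz in \<open>auto simp: W_def \<Phi>_def \<Psi>_def vec_eq_iff forall_2\<close>)
  then have "local_diffeo_at \<Phi> (\<gamma> 0)"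
    by (rule local_diffeo_atI) (use \<open>\<gamma> 0 = 0\<close> d3 in \<open>simp add: W_def\<close>)
  moreover have "local_diffeo_at \<phi> 0"
    by (rule local_diffeo_atI[OF diffeomorphism_sym[OF diff] \<open>0 \<in> ?V\<close>])
  moreover have "\<forall>\<^sub>F u in nhds 0. \<Phi> (\<gamma> (\<phi> u)) = vector [u^2, u^3]"
  proof -
    have "\<Phi> (\<gamma> (\<phi> u)) = vector [u^2, u^3]" if u: "u \<in> {-sqrt d3<..<sqrt d3}" for u
    proof -
      have "\<bar>u\<bar> < sqrt d3" using u by auto
      then have "u\<^sup>2 < d3"
        using d3(1) by (metis abs_ge_zero less_eq_real_def power2_abs power2_less_imp_less real_sqrt_abs real_sqrt_less_iff)
      then have u2: "u\<^sup>2 \<in> {-d3<..<d3}" using d3(1) by (auto intro: less_le_trans[of _ 0])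
      have "sqrt d3 \<le> e2" using d3(2) e2(1) by (simp add: real_le_lsqrt)
      then have ue: "u \<in> {-e2<..<e2}" using u by auto
      have "(\<phi> u)\<^sup>2 * a (\<phi> u) = (\<phi> u * s u)\<^sup>2"
        using apos[OF \<phi>d[OF ue]] by (simp add: s_def power_mult_distrib)
      then have 1: "(\<phi> u)\<^sup>2 * a (\<phi> u) = u\<^sup>2" by (simp add: u_eq[OF ue])
      have "\<phi> u ^ 3 * b (\<phi> u) = (\<phi> u * s u) ^ 3 * c u"
        using spos[OF ue] by (simp add: c_def power_mult_distrib)
      then have 2: "\<phi> u ^ 3 * b (\<phi> u) = u ^ 3 * c u" by (simp add: u_eq[OF ue])
      have "\<gamma> (\<phi> u) = vector [u\<^sup>2, u ^ 3 * c u]"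
        using \<gamma>[of "\<phi> u"] \<phi>d[OF ue] sub 1 2 by auto
      moreover have "u ^ 3 * c u - (u\<^sup>2)\<^sup>2 * q (u\<^sup>2) = u ^ 3 * p (u\<^sup>2)"
        unfolding cpq[OF ue] by algebra
      ultimately show ?thesis using pnz[OF u2] by (simp add: \<Phi>_def)
    qed
    then show ?thesis unfolding eventually_nhds_0_interval using d3(1) by (intro exI[of _ "sqrt d3"]) simp
  qed
  ultimately show ?thesis unfolding cusp_3_2_def using singular \<open>\<phi> 0 = 0\<close> by blast
qed

section \<open>The velocity of a cusp\<close>

lemma bracket_scaleR: "bracket (c *\<^sub>R a) (c *\<^sub>R b + k *\<^sub>R a) = c\<^sup>2 * bracket a b"
  by (simp add: bracket_def power2_eq_square algebra_simps)

text \<open>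
  If the bracket vanishes, \<open>b$2 *\<^sub>R a - a$2 *\<^sub>R b\<close> and \<open>b$1 *\<^sub>R a - a$1 *\<^sub>R b\<close> are zero; applying \<open>L\<close> to
  these relations forces \<open>a = 0\<close>.
\<close>

lemma bracket_nonzero_if_left_inverse:
  fixes L :: "real^2 \<Rightarrow> real^2"
  assumes "linear L" "L a = axis 1 1" "L b = axis 2 1"
  shows "bracket a b \<noteq> 0"
proof
  assume 0: "bracket a b = 0"
  have "b $ 2 *\<^sub>R a - a $ 2 *\<^sub>R b = 0" "b $ 1 *\<^sub>R a - a $ 1 *\<^sub>R b = 0"
    using 0 by (auto simp: bracket_def vec_eq_iff forall_2 algebra_simps)
  then have "L (b $ 2 *\<^sub>R a - a $ 2 *\<^sub>R b) = 0" "L (b $ 1 *\<^sub>R a - a $ 1 *\<^sub>R b) = 0"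
    using linear_0[OF assms(1)] by simp_all
  then have "b $ 2 *\<^sub>R axis 1 1 - a $ 2 *\<^sub>R axis 2 1 = (0::real^2)" "b $ 1 *\<^sub>R axis 1 1 - a $ 1 *\<^sub>R axis 2 1 = (0::real^2)"
    using assms(2,3) by (simp_all add: linear_diff[OF assms(1)] linear_scale[OF assms(1)])
  then have "a = 0" by (auto simp: vec_eq_iff forall_2 axis_def)
  then have "axis 1 1 = (0::real^2)" using assms(2) linear_0[OF assms(1)] by simp
  then show False by (simp add: axis_eq_0_iff)
qed

text \<open>
  Write the curve as \<open>\<gamma> t = g ((\<psi> t)\<^sup>2, (\<psi> t) ^ 3)\<close>, where \<open>\<psi>\<close> and \<open>g\<close> are the inverses of the
  coordinate changes in the definition of a cusp. The chain rule gives
  \<open>\<gamma>' = \<psi> * \<psi>' *\<^sub>R w\<close> with \<open>w = 2 *\<^sub>R g\<^sub>x + (3 * \<psi>) *\<^sub>R g\<^sub>y\<close>, the partial derivatives of \<open>g\<close> being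
  taken along the curve. Since \<open>\<psi>\<close> is divisible by \<open>t\<close>, so is \<open>\<gamma>'\<close>, with a smooth quotient \<open>v\<close>. The
  point \<open>((\<psi> t)\<^sup>2, (\<psi> t) ^ 3)\<close> has zero velocity at \<open>t = 0\<close>; therefore \<open>w' 0 = 3 * \<psi>' 0 *\<^sub>R g\<^sub>y\<close>, and
  the bracket of \<open>w 0\<close> and \<open>w' 0\<close> is \<open>6 * \<psi>' 0\<close> times the nonzero bracket of \<open>g\<^sub>x\<close> and \<open>g\<^sub>y\<close>.
  Multiplying \<open>w\<close> by a nonvanishing function multiplies this bracket by a square.
\<close>

lemma cusp_3_2_velocity:
  assumes \<epsilon>: "\<epsilon> > 0" and \<gamma>: "smooth_on {-\<epsilon><..<\<epsilon>} \<gamma>" and cusp: "cusp_3_2 \<gamma> 0"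
  obtains d v where "0 < d" "smooth_on {-d<..<d} v"
    "\<And>t. t \<in> {-d<..<d} \<Longrightarrow> (\<gamma> has_vector_derivative t *\<^sub>R v t) (at t)"
    "bracket (v 0) (vector_derivative v (at 0)) \<noteq> 0"
proof -
  obtain \<phi> :: "real \<Rightarrow> real" and \<Phi> :: "real^2 \<Rightarrow> real^2" where
    "local_diffeo_at \<phi> 0" "\<phi> 0 = 0" "local_diffeo_at \<Phi> (\<gamma> 0)"
    and nf: "\<forall>\<^sub>F u in nhds 0. \<Phi> (\<gamma> (\<phi> u)) = vector [u^2, u^3]"
    using cusp unfolding cusp_3_2_def by blast
  then obtain U V \<psi> U2 V2 g where "0 \<in> U" and d\<phi>: "diffeomorphism U V \<phi> \<psi>"
    and "\<gamma> 0 \<in> U2" and d\<Phi>: "diffeomorphism U2 V2 \<Phi> g"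
    unfolding local_diffeo_at_def by blast
  note \<phi> = diffeomorphismD[OF d\<phi>] and \<Phi> = diffeomorphismD[OF d\<Phi>]
  have "0 \<in> V" "\<psi> 0 = 0" using \<phi>(5,7)[OF \<open>0 \<in> U\<close>] \<open>\<phi> 0 = 0\<close> by auto
  have c\<psi>: "isCont \<psi> 0"
    using smooth_on_continuous_on[OF \<phi>(4)] \<phi>(2) \<open>0 \<in> V\<close> by (simp add: continuous_on_eq_continuous_at)
  have c\<gamma>: "isCont \<gamma> 0" using smooth_on_isCont[OF \<gamma>] \<epsilon> by simp
  have "\<forall>\<^sub>F t in nhds 0. \<Phi> (\<gamma> (\<phi> (\<psi> t))) = vector [(\<psi> t)^2, (\<psi> t)^3]"
    by (rule eventually_compose_filterlim[OF nf]) (use c\<psi> \<open>\<psi> 0 = 0\<close> in \<open>simp add: isCont_def tendsto_nhds_iff\<close>)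
  moreover have "\<forall>\<^sub>F t in nhds 0. \<gamma> t \<in> U2"
    using c\<gamma> \<Phi>(1) \<open>\<gamma> 0 \<in> U2\<close> by (simp add: isCont_def tendsto_nhds_iff topological_tendstoD)
  moreover have "\<forall>\<^sub>F t in nhds 0. t \<in> V" using \<phi>(2) \<open>0 \<in> V\<close> by (rule eventually_nhds_in_open)
  ultimately have "\<forall>\<^sub>F t in nhds 0. t \<in> V \<and> vector [(\<psi> t)^2, (\<psi> t)^3] \<in> V2 \<and> \<gamma> t = g (vector [(\<psi> t)^2, (\<psi> t)^3])"
    by eventually_elim (metis \<phi>(8) \<Phi>(5,7))
  then obtain d where d: "d > 0" and dV: "{-d<..<d} \<subseteq> V"
    and PV2: "\<And>t. t \<in> {-d<..<d} \<Longrightarrow> vector [(\<psi> t)^2, (\<psi> t)^3] \<in> V2"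
    and \<gamma>_eq: "\<And>t. t \<in> {-d<..<d} \<Longrightarrow> \<gamma> t = g (vector [(\<psi> t)^2, (\<psi> t)^3])"
    unfolding eventually_nhds_0_interval by blast
  let ?I = "{-d<..<d}"
  define P where "P t = (vector [(\<psi> t)^2, (\<psi> t)^3] :: real^2)" for t
  have \<psi>: "smooth_on ?I \<psi>" by (rule smooth_on_subset[OF \<phi>(4) dV])
  have P: "smooth_on ?I P" unfolding P_def[abs_def]
    by (intro smooth_on_vector_2 smooth_on_power \<psi>) auto
  obtain \<psi>' where \<psi>': "smooth_on ?I \<psi>'" "\<And>t. t \<in> ?I \<Longrightarrow> (\<psi> has_vector_derivative \<psi>' t) (at t)"
    using smooth_on_vderivE[OF \<psi>] by auto
  have D\<psi>: "(\<psi> has_real_derivative \<psi>' t) (at t)" if "t \<in> ?I" for t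
    using \<psi>'(2)[OF that] by (simp add: has_real_derivative_iff_has_vector_derivative)
  have dP: "(P has_vector_derivative (\<psi> t * \<psi>' t) *\<^sub>R (2 *\<^sub>R axis 1 1 + (3 * \<psi> t) *\<^sub>R axis 2 1)) (at t)"
    if t: "t \<in> ?I" for t
  proof -
    have "(P has_vector_derivative (2 * \<psi> t * \<psi>' t) *\<^sub>R axis 1 1 + (3 * (\<psi> t)\<^sup>2 * \<psi>' t) *\<^sub>R axis 2 1) (at t)"
      unfolding P_def[abs_def] vector_2_eq
      by (rule has_vector_derivative_add; rule bounded_linear.has_vector_derivative[OF bounded_linear_scaleR_left];
          unfold has_real_derivative_iff_has_vector_derivative[symmetric];
          insert D\<psi>[OF t]; auto intro!: derivative_eq_intros)
    then show ?thesis by (simp add: scaleR_add_right power2_eq_square mult_ac)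
  qed
  define gx where "gx i y = frechet_derivative g (at y) (axis i 1)" for i :: 2 and y
  have gx: "smooth_on V2 (gx i)" for i
    unfolding gx_def[abs_def] by (rule smooth_on_frechet_derivative(1)[OF \<Phi>(4)])
  have dg: "(g has_derivative frechet_derivative g (at y)) (at y)" if "y \<in> V2" for y
    by (rule smooth_on_frechet_derivative(2)[OF \<Phi>(4) that])
  have gxP: "smooth_on ?I (\<lambda>t. gx i (P t))" for i
    by (rule smooth_on_compose[OF gx \<Phi>(2) _ _ P]) (use PV2 in \<open>auto simp: P_def\<close>)
  define w where "w t = 2 *\<^sub>R gx 1 (P t) + (3 * \<psi> t) *\<^sub>R gx 2 (P t)" for t
  have w: "smooth_on ?I w" unfolding w_def[abs_def]
    by (intro smooth_on_add smooth_on_scaleR smooth_on_mult smooth_on_const \<psi> gxP) auto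
  have d\<gamma>: "(\<gamma> has_vector_derivative (\<psi> t * \<psi>' t) *\<^sub>R w t) (at t)" if t: "t \<in> ?I" for t
  proof -
    have y: "P t \<in> V2" using PV2[OF t] by (simp add: P_def)
    have lin: "linear (frechet_derivative g (at (P t)))" using dg[OF y] by (rule has_derivative_linear)
    have "((\<lambda>t. g (P t)) has_derivative (\<lambda>h. frechet_derivative g (at (P t))
        (h *\<^sub>R (\<psi> t * \<psi>' t) *\<^sub>R (2 *\<^sub>R axis 1 1 + (3 * \<psi> t) *\<^sub>R axis 2 1)))) (at t)"
      using has_derivative_compose[OF dP[OF t, unfolded has_vector_derivative_def] dg[OF y]] .
    then have "((\<lambda>t. g (P t)) has_vector_derivative (\<psi> t * \<psi>' t) *\<^sub>R w t) (at t)"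
      unfolding has_vector_derivative_def w_def gx_def
      by (simp add: linear_scale[OF lin] linear_add[OF lin])
    then show ?thesis
      by (rule has_vector_derivative_transform_within_open[where S="?I"]) (use t \<gamma>_eq in \<open>auto simp: P_def\<close>)
  qed
  obtain m where m: "smooth_on ?I m" "\<And>t. t \<in> ?I \<Longrightarrow> \<psi> t = t * m t"
    using Hadamard[OF \<psi>] \<open>\<psi> 0 = 0\<close> by auto
  have "(\<psi> has_vector_derivative m 0) (at 0)"
    by (rule has_vector_derivative_transform_within_open[OF ident_scaleR_derivative[OF m(1) d], where S="?I"])
      (use d m(2) in auto)
  moreover have \<psi>'0: "(\<psi> has_vector_derivative \<psi>' 0) (at 0)" using \<psi>'(2) d by simp
  ultimately have m0: "m 0 = \<psi>' 0" by (rule vector_derivative_unique_at)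
  have "\<psi>' 0 \<noteq> 0"
  proof
    assume "\<psi>' 0 = 0"
    have "(\<phi> has_derivative frechet_derivative \<phi> (at (\<psi> 0))) (at (\<psi> 0))"
      using smooth_on_frechet_derivative(2)[OF \<phi>(3) \<open>0 \<in> U\<close>] \<open>\<psi> 0 = 0\<close> by simp
    from has_derivative_compose[OF \<psi>'0[unfolded has_vector_derivative_def] this]
    have "((\<lambda>t. \<phi> (\<psi> t)) has_derivative (\<lambda>h. 0)) (at 0)"
      using linear_0[OF has_derivative_linear[OF \<open>(\<phi> has_derivative _) _\<close>]] \<open>\<psi>' 0 = 0\<close> by simp
    then have "((\<lambda>t. t) has_derivative (\<lambda>h. 0)) (at (0::real))"
      by (rule has_derivative_transform_within_open[OF _ \<phi>(2) \<open>0 \<in> V\<close>]) (simp add: \<phi>(8))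
    then have "(\<lambda>h::real. 0) = (\<lambda>h::real. h)" using has_derivative_unique has_derivative_ident by blast
    then show False by (metis zero_neq_one)
  qed
  have P0: "P 0 = 0" "P 0 \<in> V2" using PV2[of 0] d \<open>\<psi> 0 = 0\<close> by (auto simp: P_def vec_eq_iff forall_2)
  have br: "bracket (gx 1 (P 0)) (gx 2 (P 0)) \<noteq> 0"
  proof -
    let ?L = "frechet_derivative \<Phi> (at (g (P 0)))"
    have L: "(\<Phi> has_derivative ?L) (at (g (P 0)))"
      by (rule smooth_on_frechet_derivative(2)[OF \<Phi>(3) \<Phi>(6)[OF P0(2)]])
    have "((\<lambda>y. y) has_derivative (\<lambda>h. ?L (frechet_derivative g (at (P 0)) h))) (at (P 0))"
      by (rule has_derivative_transform_within_open[OF has_derivative_compose[OF dg[OF P0(2)] L] \<Phi>(2) P0(2)])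
        (simp add: \<Phi>(8))
    then have "(\<lambda>h. ?L (frechet_derivative g (at (P 0)) h)) = (\<lambda>h. h)"
      using has_derivative_unique has_derivative_ident by blast
    then have "?L (gx i (P 0)) = axis i 1" for i unfolding gx_def by meson
    then show ?thesis
      by (intro bracket_nonzero_if_left_inverse[OF has_derivative_linear[OF L]])
  qed
  have dgxP0: "((\<lambda>t. gx i (P t)) has_vector_derivative 0) (at 0)" for i
  proof -
    have "(gx i has_derivative frechet_derivative (gx i) (at (P 0))) (at (P 0))"
      by (rule smooth_on_frechet_derivative(2)[OF gx P0(2)])
    moreover have "(P has_derivative (\<lambda>h. 0)) (at 0)"
      using dP[of 0] d \<open>\<psi> 0 = 0\<close> by (simp add: has_vector_derivative_def)
    ultimately have "((\<lambda>t. gx i (P t)) has_derivative (\<lambda>h. frechet_derivative (gx i) (at (P 0)) 0)) (at 0)"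
      by (rule has_derivative_compose[rotated])
    then show ?thesis
      using linear_0[OF has_derivative_linear[OF \<open>(gx i has_derivative _) _\<close>]] by (simp add: has_vector_derivative_def)
  qed
  have dw: "(w has_vector_derivative (3 * \<psi>' 0) *\<^sub>R gx 2 (P 0)) (at 0)"
  proof -
    have "((\<lambda>t. 3 * \<psi> t) has_real_derivative 3 * \<psi>' 0) (at 0)"
      by (rule DERIV_cmult) (use D\<psi> d in simp)
    from has_vector_derivative_scaleR[OF this dgxP0[of 2]]
    have "((\<lambda>t. (3 * \<psi> t) *\<^sub>R gx 2 (P t)) has_vector_derivative (3 * \<psi>' 0) *\<^sub>R gx 2 (P 0)) (at 0)" by simp
    from has_vector_derivative_add[OF bounded_linear.has_vector_derivative[OF bounded_linear_scaleR_right dgxP0[of 1], of 2] this]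
    show ?thesis unfolding w_def[abs_def] by simp
  qed
  \<comment> \<open>Absorbing \<open>\<psi> t = t * m t\<close>, the velocity \<open>\<psi> t * \<psi>' t *\<^sub>R w t\<close> becomes \<open>t *\<^sub>R M t *\<^sub>R w t\<close>.\<close>
  define M where "M t = m t * \<psi>' t" for t
  have M: "smooth_on ?I M" unfolding M_def[abs_def] by (intro smooth_on_mult m \<psi>') auto
  obtain M' where "(M has_vector_derivative M') (at 0)" 
    using smooth_on_vderivE[OF M] d by (metis greaterThanLessThan_iff neg_less_0_iff_less open_greaterThanLessThan)
  then have "(M has_real_derivative M') (at 0)" by (simp add: has_real_derivative_iff_has_vector_derivative)
  from has_vector_derivative_scaleR[OF this dw]
  have dv: "vector_derivative (\<lambda>t. M t *\<^sub>R w t) (at 0) = M 0 *\<^sub>R ((3 * \<psi>' 0) *\<^sub>R gx 2 (P 0)) + M' *\<^sub>R w 0"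
    by (rule vector_derivative_at)
  show thesis
  proof (rule that[OF d, of "\<lambda>t. M t *\<^sub>R w t"])
    show "smooth_on ?I (\<lambda>t. M t *\<^sub>R w t)" by (intro smooth_on_scaleR M w) auto
    show "(\<gamma> has_vector_derivative t *\<^sub>R M t *\<^sub>R w t) (at t)" if "t \<in> ?I" for t
      using d\<gamma>[OF that] m(2)[OF that] by (simp add: M_def mult_ac)
    have "bracket (w 0) ((3 * \<psi>' 0) *\<^sub>R gx 2 (P 0)) = 6 * \<psi>' 0 * bracket (gx 1 (P 0)) (gx 2 (P 0))"
      by (simp add: w_def \<open>\<psi> 0 = 0\<close> bracket_def algebra_simps)
    then show "bracket (M 0 *\<^sub>R w 0) (vector_derivative (\<lambda>t. M t *\<^sub>R w t) (at 0)) \<noteq> 0"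
      unfolding dv bracket_scaleR using br \<open>\<psi>' 0 \<noteq> 0\<close> m0 by (simp add: M_def)
  qed
qed

lemma nth_deriv_1_velocity:
  assumes "\<And>t. t \<in> {-d<..<d} \<Longrightarrow> (\<gamma> has_vector_derivative t *\<^sub>R v t) (at t)" "t \<in> {-d<..<d}"
  shows "nth_deriv 1 \<gamma> t = t *\<^sub>R v t"
  using vector_derivative_at[OF assms(1)[OF assms(2)]] by (simp add: nth_deriv_def)

lemma nth_deriv_2_velocity:
  assumes \<gamma>: "\<And>t. t \<in> {-d<..<d} \<Longrightarrow> (\<gamma> has_vector_derivative t *\<^sub>R v t) (at t)"
    and v: "\<And>t. t \<in> {-d<..<d} \<Longrightarrow> (v has_vector_derivative v' t) (at t)"
    and t: "t \<in> {-d<..<d}"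
  shows "nth_deriv 2 \<gamma> t = v t + t *\<^sub>R v' t"
proof -
  have "((\<lambda>t. t *\<^sub>R v t) has_vector_derivative v t + t *\<^sub>R v' t) (at t)"
    using has_vector_derivative_scaleR[OF DERIV_ident v[OF t]] by (simp add: add.commute)
  then have "(nth_deriv 1 \<gamma> has_vector_derivative v t + t *\<^sub>R v' t) (at t)"
    by (rule has_vector_derivative_transform_within_open[where S="{-d<..<d}"])
      (use t nth_deriv_1_velocity[of d \<gamma> v, OF \<gamma>] in auto)
  then show ?thesis by (simp add: nth_deriv_def numeral_2_eq_2 vector_derivative_at)
qed

lemma nth_deriv_3_velocity:
  assumes \<gamma>: "\<And>t. t \<in> {-d<..<d} \<Longrightarrow> (\<gamma> has_vector_derivative t *\<^sub>R v t) (at t)"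
    and v: "\<And>t. t \<in> {-d<..<d} \<Longrightarrow> (v has_vector_derivative v' t) (at t)"
    and v': "\<And>t. t \<in> {-d<..<d} \<Longrightarrow> (v' has_vector_derivative v'' t) (at t)"
    and t: "t \<in> {-d<..<d}"
  shows "nth_deriv 3 \<gamma> t = 2 *\<^sub>R v' t + t *\<^sub>R v'' t"
proof -
  have "((\<lambda>t. v t + t *\<^sub>R v' t) has_vector_derivative v' t + (t *\<^sub>R v'' t + 1 *\<^sub>R v' t)) (at t)"
    by (rule has_vector_derivative_add[OF v[OF t] has_vector_derivative_scaleR[OF DERIV_ident v'[OF t]]])
  then have "(nth_deriv 2 \<gamma> has_vector_derivative v' t + (t *\<^sub>R v'' t + 1 *\<^sub>R v' t)) (at t)"
    by (rule has_vector_derivative_transform_within_open[where S="{-d<..<d}"])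
      (use t nth_deriv_2_velocity[of d \<gamma> v v', OF \<gamma> v] in auto)
  then have "nth_deriv 3 \<gamma> t = v' t + (t *\<^sub>R v'' t + 1 *\<^sub>R v' t)"
    by (simp add: nth_deriv_def numeral_3_eq_3 numeral_2_eq_2 vector_derivative_at)
  then show ?thesis by (simp add: scaleR_2)
qed

section \<open>Arclength and curvature of a cusp\<close>

text \<open>
  The speed is \<open>\<bar>t\<bar> * norm (v t)\<close>, and \<open>\<bar>t\<bar> * t * A t\<close> is a primitive of it also at \<open>t = 0\<close>, in spite
  of the absolute value, because there the difference quotient \<open>\<bar>h\<bar> * A h\<close> tends to zero.
\<close>

lemma arclength_eq_signed_square:
  fixes A :: "real \<Rightarrow> real"
  assumes \<gamma>: "\<And>t. t \<in> {-d<..<d} \<Longrightarrow> (\<gamma> has_vector_derivative t *\<^sub>R v t) (at t)"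
    and v: "smooth_on {-d<..<d} v" and A: "smooth_on {-d<..<d} A"
    and dA: "\<And>t. t \<in> {-d<..<d} \<Longrightarrow> ((\<lambda>t. t\<^sup>2 * A t) has_real_derivative t * norm (v t)) (at t)"
    and t: "t \<in> {-d<..<d}"
  shows "arclength \<gamma> t = \<bar>t\<bar> * t * A t"
proof -
  let ?S = "\<lambda>t. \<bar>t\<bar> * t * A t"
  have d: "d > 0" using t by auto
  have speed: "norm (nth_deriv 1 \<gamma> u) = \<bar>u\<bar> * norm (v u)" if "u \<in> {-d<..<d}" for u
    using nth_deriv_1_velocity[of d \<gamma> v, OF \<gamma> that] by simp
  have dS: "(?S has_real_derivative \<bar>u\<bar> * norm (v u)) (at u)" if u: "u \<in> {-d<..<d}" for u
  proof -
    consider "u > 0" | "u < 0" | "u = 0" by linarith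
    then show ?thesis
    proof cases
      case 1
      have "(?S has_real_derivative u * norm (v u)) (at u)"
        by (rule has_field_derivative_transform_within_open[OF dA[OF u], where S="{0<..}"])
          (use 1 in \<open>auto simp: power2_eq_square\<close>)
      then show ?thesis using 1 by simp
    next
      case 2
      have "(?S has_real_derivative - (u * norm (v u))) (at u)"
        by (rule has_field_derivative_transform_within_open[OF DERIV_minus[OF dA[OF u]], where S="{..<0}"])
          (use 2 in \<open>auto simp: power2_eq_square\<close>)
      then show ?thesis using 2 by simp
    next
      case 3
      have "isCont (\<lambda>h. \<bar>h\<bar> * A h) 0"
        using smooth_on_isCont[OF A, of 0] d by (intro continuous_intros) auto
      then have "((\<lambda>h. \<bar>h\<bar> * A h) \<longlongrightarrow> 0) (at 0)" by (simp add: isCont_def)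
      moreover have "(\<lambda>h. (?S (0 + h) - ?S 0) / h) = (\<lambda>h. \<bar>h\<bar> * A h)" by auto
      ultimately show ?thesis unfolding 3 DERIV_def by simp
    qed
  qed
  have sub: "{min 0 t..max 0 t} \<subseteq> {-d<..<d}" using t d by auto
  have "(LBINT u=ereal 0..ereal t. norm (nth_deriv 1 \<gamma> u)) = ?S t - ?S 0"
  proof (rule interval_integral_FTC_finite)
    have "continuous_on {min 0 t..max 0 t} (\<lambda>u. \<bar>u\<bar> * norm (v u))"
      using continuous_on_subset[OF smooth_on_continuous_on[OF v] sub] by (intro continuous_intros)
    then show "continuous_on {min 0 t..max 0 t} (\<lambda>u. norm (nth_deriv 1 \<gamma> u))"
      by (rule continuous_on_eq) (use sub speed in auto)
    show "(?S has_vector_derivative norm (nth_deriv 1 \<gamma> u)) (at u within {min 0 t..max 0 t})"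
      if "min 0 t \<le> u" "u \<le> max 0 t" for u
    proof -
      have "u \<in> {-d<..<d}" using that sub by auto
      then show ?thesis
        using dS[of u] speed[of u]
        by (simp add: has_real_derivative_iff_has_vector_derivative has_vector_derivative_at_within)
    qed
  qed
  then show ?thesis by (simp add: arclength_def)
qed

lemma half_arclength_eq:
  assumes "arclength \<gamma> t = \<bar>t\<bar> * t * A" "A \<ge> 0"
  shows "half_arclength \<gamma> t = t * sqrt A"
  unfolding half_arclength_def assms(1) using assms(2)
  by (simp add: abs_mult real_sqrt_mult mult.assoc[symmetric] sgn_mult_abs flip: power2_eq_square)

text \<open>
  With \<open>\<gamma>' = t *\<^sub>R v\<close> and \<open>\<gamma>'' = v + t *\<^sub>R v'\<close> the curvature is
  \<open>t\<^sup>2 * bracket v v' / (\<bar>t\<bar> ^ 3 * norm v ^ 3)\<close>. The factor \<open>\<bar>t\<bar>\<close> in the square root of the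
  arclength cancels its pole.
\<close>

lemma normalized_curvature_eq:
  assumes \<gamma>: "\<And>t. t \<in> {-d<..<d} \<Longrightarrow> (\<gamma> has_vector_derivative t *\<^sub>R v t) (at t)"
    and v': "\<And>t. t \<in> {-d<..<d} \<Longrightarrow> (v has_vector_derivative v' t) (at t)"
    and s: "arclength \<gamma> t = \<bar>t\<bar> * t * A" "A \<ge> 0" and t: "t \<in> {-d<..<d}" "t \<noteq> 0" 
  shows "normalized_curvature \<gamma> t = sqrt A * bracket (v t) (v' t) / norm (v t) ^ 3"
proof -
  have 1: "nth_deriv 1 \<gamma> t = t *\<^sub>R v t"
    by (rule nth_deriv_1_velocity[OF \<gamma> t(1)])
  have 2: "nth_deriv 2 \<gamma> t = v t + t *\<^sub>R v' t"
    by (rule nth_deriv_2_velocity[OF \<gamma> v' t(1)])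
  have cube: "\<bar>t\<bar> * t\<^sup>2 = \<bar>t\<bar> ^ 3" by (simp add: power3_eq_cube power2_eq_square abs_mult_self_eq flip: mult.assoc)
  have "bracket (t *\<^sub>R v t) (v t + t *\<^sub>R v' t) = t\<^sup>2 * bracket (v t) (v' t)"
    by (simp add: bracket_def power2_eq_square algebra_simps)
  then have "curvature \<gamma> t = t\<^sup>2 * bracket (v t) (v' t) / (\<bar>t\<bar> ^ 3 * norm (v t) ^ 3)"
    unfolding curvature_def 1 2 by (simp add: power_mult_distrib)
  moreover have "sqrt \<bar>arclength \<gamma> t\<bar> = \<bar>t\<bar> * sqrt A"
    unfolding s(1) using s(2) by (simp add: abs_mult real_sqrt_mult flip: power2_eq_square)
  ultimately have "normalized_curvature \<gamma> t =
      (\<bar>t\<bar> * sqrt A) * (t\<^sup>2 * bracket (v t) (v' t) / (\<bar>t\<bar> ^ 3 * norm (v t) ^ 3))"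
    by (simp only: normalized_curvature_def)
  also have "\<dots> = (\<bar>t\<bar> * t\<^sup>2) / \<bar>t\<bar> ^ 3 * (sqrt A * bracket (v t) (v' t) / norm (v t) ^ 3)"
    by (simp add: mult_ac)
  also have "(\<bar>t\<bar> * t\<^sup>2) / \<bar>t\<bar> ^ 3 = 1" using cube t(2) by simp
  finally show ?thesis by simp
qed

text \<open>
  Apart from the velocity quotient \<open>v\<close>, everything is expressed by the first moment \<open>A\<close> of its norm:
  \<open>F = sqrt A * bracket v v' / norm v ^ 3\<close>. The value at \<open>0\<close> follows from \<open>A 0 = norm (v 0) / 2\<close> and
  from the second and third derivatives \<open>v 0\<close> and \<open>2 *\<^sub>R v' 0\<close> of \<open>\<gamma>\<close> at \<open>0\<close>.
\<close>

lemma cusp_local_form: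
  assumes e: "e > 0" and v: "smooth_on {-e<..<e} v" "v 0 \<noteq> 0"
    and \<gamma>: "\<And>t. t \<in> {-e<..<e} \<Longrightarrow> (\<gamma> has_vector_derivative t *\<^sub>R v t) (at t)"
  obtains d :: real and A F :: "real \<Rightarrow> real" where "0 < d" "smooth_on {-d<..<d} A" "smooth_on {-d<..<d} F"
    "\<And>t. t \<in> {-d<..<d} \<Longrightarrow> A t > 0"
    "\<And>t. t \<in> {-d<..<d} \<Longrightarrow> half_arclength \<gamma> t = t * sqrt (A t)"
    "\<And>t. t \<in> {-d<..<d} \<Longrightarrow> t \<noteq> 0 \<Longrightarrow> nth_deriv 1 \<gamma> t \<noteq> 0"
    "\<And>t. t \<in> {-d<..<d} \<Longrightarrow> t \<noteq> 0 \<Longrightarrow> normalized_curvature \<gamma> t = F t"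
    "F 0 = cuspidal_curvature \<gamma> 0 / (2 * sqrt 2)"
proof -
  \<comment> \<open>Near \<open>0\<close> the vector \<open>v t\<close> has a positive component along \<open>v 0\<close> and so does not vanish.\<close>
  have "smooth_on {-e<..<e} (\<lambda>t. v t \<bullet> v 0)"
    by (rule smooth_on_linear_compose[OF bounded_linear_inner_left _ v(1)]) simp
  then obtain d1 where d1: "0 < d1" "d1 \<le> e" "\<And>t. t \<in> {-d1<..<d1} \<Longrightarrow> v t \<bullet> v 0 > 0"
    by (rule positive_interval) (use e v(2) in auto)
  have vnz: "v t \<noteq> 0" if "t \<in> {-d1<..<d1}" for t using d1(3)[OF that] by auto
  have "{-d1<..<d1} \<subseteq> {-e<..<e}" using d1(2) by auto
  from smooth_on_subset[OF v(1) this] have v1: "smooth_on {-d1<..<d1} v" .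
  have N: "smooth_on {-d1<..<d1} (\<lambda>t. norm (v t))"
    by (rule smooth_on_norm[OF v1 _ vnz]) auto
  obtain A where A: "smooth_on {-d1<..<d1} A"
    "\<And>t. t \<in> {-d1<..<d1} \<Longrightarrow> ((\<lambda>t. t ^ Suc 1 *\<^sub>R A t) has_vector_derivative t ^ 1 *\<^sub>R norm (v t)) (at t)"
    "d1 > 0 \<Longrightarrow> real (Suc 1) *\<^sub>R A 0 = norm (v 0)"
    using smooth_moment[OF N, where n=1] by blast
  have A0: "2 * A 0 = norm (v 0)" using A(3) d1(1) by simp
  have dA: "((\<lambda>t. t\<^sup>2 * A t) has_real_derivative t * norm (v t)) (at t)" if "t \<in> {-d1<..<d1}" for t
    using A(2)[OF that] by (simp add: numeral_2_eq_2 has_real_derivative_iff_has_vector_derivative)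
  have "A 0 > 0" using A0 vnz[of 0] d1(1) by (metis mult_pos_pos zero_less_norm_iff zero_less_mult_pos zero_less_numeral v(2))
  obtain d where d: "0 < d" "d \<le> d1" "\<And>t. t \<in> {-d<..<d} \<Longrightarrow> A t > 0"
    using positive_interval[OF A(1) d1(1) \<open>A 0 > 0\<close>] by blast
  have sub: "{-d<..<d} \<subseteq> {-d1<..<d1}" "{-d<..<d} \<subseteq> {-e<..<e}" using d(2) d1(2) by auto
  have vd: "smooth_on {-d<..<d} v" and Ad: "smooth_on {-d<..<d} A" and Nd: "smooth_on {-d<..<d} (\<lambda>t. norm (v t))"
    using smooth_on_subset[OF v1 sub(1)] smooth_on_subset[OF A(1) sub(1)] smooth_on_subset[OF N sub(1)] .
  obtain v' where v': "smooth_on {-d<..<d} v'" "\<And>t. t \<in> {-d<..<d} \<Longrightarrow> (v has_vector_derivative v' t) (at t)"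
    using smooth_on_vderivE[OF vd] by auto
  obtain v'' where v'': "\<And>t. t \<in> {-d<..<d} \<Longrightarrow> (v' has_vector_derivative v'' t) (at t)"
    using smooth_on_vderivE[OF v'(1)] by auto
  have \<gamma>d: "(\<gamma> has_vector_derivative t *\<^sub>R v t) (at t)" if "t \<in> {-d<..<d}" for t
    using \<gamma> that sub(2) by blast
  have s: "arclength \<gamma> t = \<bar>t\<bar> * t * A t" if t: "t \<in> {-d<..<d}" for t
    by (rule arclength_eq_signed_square[OF \<gamma>d vd Ad dA t]) (use sub(1) in blast)+
  define F where "F t = sqrt (A t) * bracket (v t) (v' t) / norm (v t) ^ 3" for t
  show thesis
  proof (rule that[OF d(1) Ad _ d(3)])
    show "smooth_on {-d<..<d} F" unfolding F_def[abs_def]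
      by (intro smooth_on_divide smooth_on_mult smooth_on_power smooth_on_bracket smooth_on_sqrt Ad vd v'(1) Nd)
        (use vnz sub(1) d(3) in auto)
    fix t assume t: "t \<in> {-d<..<d}"
    show "half_arclength \<gamma> t = t * sqrt (A t)"
      by (rule half_arclength_eq[OF s[OF t]]) (use d(3)[OF t] in simp)
    assume "t \<noteq> 0"
    have "v t \<noteq> 0" using vnz sub(1) t by blast
    then show "nth_deriv 1 \<gamma> t \<noteq> 0"
      using nth_deriv_1_velocity[of d \<gamma> v, OF \<gamma>d t] \<open>t \<noteq> 0\<close> by simp
    show "normalized_curvature \<gamma> t = F t" unfolding F_def
      by (rule normalized_curvature_eq[OF \<gamma>d v'(2) s[OF t] _ t \<open>t \<noteq> 0\<close>]) (use d(3)[OF t] in auto)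
  next
    have 0: "0 \<in> {-d<..<d}" using d(1) by simp
    let ?n = "norm (v 0)"
    have n: "?n > 0" using v(2) by simp
    have "nth_deriv 2 \<gamma> 0 = v 0" "nth_deriv 3 \<gamma> 0 = 2 *\<^sub>R v' 0"
      using nth_deriv_2_velocity[of d \<gamma> v v', OF \<gamma>d v'(2) 0] nth_deriv_3_velocity[of d \<gamma> v v' v'', OF \<gamma>d v'(2) v'' 0]
    by simp_all
    then have "cuspidal_curvature \<gamma> 0 = 2 * bracket (v 0) (v' 0) / ?n powr (5/2)"
      by (simp add: cuspidal_curvature_def bracket_def algebra_simps)
    also have "?n powr (5/2) = ?n powr 2 * ?n powr (1/2)" by (subst powr_add[symmetric]) simp
    also have "\<dots> = ?n\<^sup>2 * sqrt ?n" using n by (simp add: powr_half_sqrt)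
    finally have "cuspidal_curvature \<gamma> 0 / (2 * sqrt 2) = bracket (v 0) (v' 0) / (sqrt 2 * (?n\<^sup>2 * sqrt ?n))"
      by simp
    moreover have "F 0 = (sqrt ?n / sqrt 2) * bracket (v 0) (v' 0) / (?n\<^sup>2 * (sqrt ?n * sqrt ?n))"
    proof -
      have "A 0 = ?n / 2" using A0 by simp
      moreover have "?n ^ 3 = ?n\<^sup>2 * (sqrt ?n * sqrt ?n)" using n by (simp add: power3_eq_cube power2_eq_square)
      ultimately show ?thesis unfolding F_def by (simp only: real_sqrt_divide)
    qed
    ultimately show "F 0 = cuspidal_curvature \<gamma> 0 / (2 * sqrt 2)"
      using n by (simp del: real_sqrt_mult_self)
  qed
qed

section \<open>Curves with prescribed normalized curvature\<close>

text \<open>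
  The half-arclength parameter means that the arclength is \<open>\<bar>t\<bar> * t\<close>, so the speed must be
  \<open>2 * \<bar>t\<bar>\<close> and \<open>\<gamma>' = t *\<^sub>R (2 * cos \<theta>, 2 * sin \<theta>)\<close> for a smooth angle \<open>\<theta>\<close>. The normalized curvature
  is then \<open>\<theta>' / 2\<close>, which leads to \<open>\<theta> t = 2 * \<integral> f\<close>. With \<open>\<theta> 0 = 0\<close> the first coordinate of the
  curve is \<open>t\<^sup>2 * a t\<close>, and the second is \<open>t ^ 3 * b t\<close> because \<open>sin \<theta>\<close> is divisible by \<open>t\<close>; here
  \<open>a 0 = 1\<close> and \<open>b 0 = 4 * f 0 / 3\<close>, so the normal form applies.
\<close>

lemma cusp_with_prescribed_curvature:
  fixes f :: "real \<Rightarrow> real"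
  assumes \<eta>: "\<eta> > 0" and f: "smooth_on {-\<eta><..<\<eta>} f" "f 0 \<noteq> 0"
  obtains \<gamma> where "smooth_on {-\<eta><..<\<eta>} \<gamma>" "cusp_3_2 \<gamma> 0"
    "\<And>t. t \<in> {-\<eta><..<\<eta>} \<Longrightarrow> half_arclength \<gamma> t = t"
    "\<And>t. t \<in> {-\<eta><..<\<eta>} \<Longrightarrow> t \<noteq> 0 \<Longrightarrow> nth_deriv 1 \<gamma> t \<noteq> 0 \<and> normalized_curvature \<gamma> t = f t"
proof -
  let ?I = "{-\<eta><..<\<eta>}"
  obtain g where g: "smooth_on ?I g" 
    "\<And>t. t \<in> ?I \<Longrightarrow> ((\<lambda>t. t ^ Suc 0 *\<^sub>R g t) has_vector_derivative t ^ 0 *\<^sub>R f t) (at t)"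
    using smooth_moment[OF f(1), where n=0] by blast
  define \<theta> where "\<theta> t = 2 * (t * g t)" for t
  have \<theta>: "smooth_on ?I \<theta>" unfolding \<theta>_def[abs_def]
    by (intro smooth_on_mult smooth_on_const smooth_on_id g) auto
  have d\<theta>: "(\<theta> has_real_derivative 2 * f t) (at t)" if "t \<in> ?I" for t
    unfolding \<theta>_def[abs_def] using g(2)[OF that] 
    by (intro DERIV_cmult) (simp add: has_real_derivative_iff_has_vector_derivative)
  have "\<theta> 0 = 0" by (simp add: \<theta>_def)
  have cs: "smooth_on ?I (\<lambda>t. cos (\<theta> t))" "smooth_on ?I (\<lambda>t. sin (\<theta> t))"
    by (rule smooth_on_compose[OF smooth_on_sin_cos(2) _ _ _ \<theta>] smooth_on_compose[OF smooth_on_sin_cos(1) _ _ _ \<theta>]; simp)+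
  obtain w where w: "smooth_on ?I w" "\<And>t. t \<in> ?I \<Longrightarrow> sin (\<theta> t) = t * w t"
    using Hadamard[OF cs(2)] \<open>\<theta> 0 = 0\<close> by auto
  have "w 0 = 2 * f 0"
  proof -
    have "((\<lambda>t. sin (\<theta> t)) has_real_derivative cos (\<theta> 0) * (2 * f 0)) (at 0)"
      by (rule DERIV_chain2[OF DERIV_sin d\<theta>]) (use \<eta> in simp)
    then have "((\<lambda>t. sin (\<theta> t)) has_vector_derivative 2 * f 0) (at 0)"
      using \<open>\<theta> 0 = 0\<close> by (simp add: has_real_derivative_iff_has_vector_derivative)
    moreover have "((\<lambda>t. sin (\<theta> t)) has_vector_derivative w 0) (at 0)"
      by (rule has_vector_derivative_transform_within_open[OF ident_scaleR_derivative[OF w(1) \<eta>], where S="?I"])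
        (use \<eta> w(2) in auto)
    ultimately show ?thesis by (rule vector_derivative_unique_at[symmetric])
  qed
  have "smooth_on ?I (\<lambda>t. 2 * cos (\<theta> t))" "smooth_on ?I (\<lambda>t. 2 * w t)"
    by (intro smooth_on_mult smooth_on_const cs w; simp)+
  note cw = this
  obtain a where a: "smooth_on ?I a"
    "\<And>t. t \<in> ?I \<Longrightarrow> ((\<lambda>t. t ^ Suc 1 *\<^sub>R a t) has_vector_derivative t ^ 1 *\<^sub>R (2 * cos (\<theta> t))) (at t)"
    "\<eta> > 0 \<Longrightarrow> real (Suc 1) *\<^sub>R a 0 = 2 * cos (\<theta> 0)"
    using smooth_moment[OF cw(1), where n=1] by blast
  obtain b where b: "smooth_on ?I b"
    "\<And>t. t \<in> ?I \<Longrightarrow> ((\<lambda>t. t ^ Suc 2 *\<^sub>R b t) has_vector_derivative t ^ 2 *\<^sub>R (2 * w t)) (at t)"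
    "\<eta> > 0 \<Longrightarrow> real (Suc 2) *\<^sub>R b 0 = 2 * w 0"
    using smooth_moment[OF cw(2), where n=2] by blast
  define v where "v t = (vector [2 * cos (\<theta> t), 2 * sin (\<theta> t)] :: real^2)" for t
  define v' where "v' t = (vector [- 4 * f t * sin (\<theta> t), 4 * f t * cos (\<theta> t)] :: real^2)" for t
  define \<gamma> where "\<gamma> t = (vector [t\<^sup>2 * a t, t ^ 3 * b t] :: real^2)" for t
  have v: "smooth_on ?I v" unfolding v_def[abs_def]
    by (intro smooth_on_vector_2 smooth_on_mult smooth_on_const cs) auto
  have dv: "(v has_vector_derivative v' t) (at t)" if "t \<in> ?I" for t
  proof -
    have "((\<lambda>t. 2 * cos (\<theta> t)) has_real_derivative - 4 * f t * sin (\<theta> t)) (at t)"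
      "((\<lambda>t. 2 * sin (\<theta> t)) has_real_derivative 4 * f t * cos (\<theta> t)) (at t)"
      using d\<theta>[OF that] by (auto intro!: derivative_eq_intros)
    then show ?thesis unfolding v_def[abs_def] v'_def vector_2_eq
      by (intro has_vector_derivative_add bounded_linear.has_vector_derivative[OF bounded_linear_scaleR_left])
        (simp_all add: has_real_derivative_iff_has_vector_derivative)
  qed
  have norm_v: "norm (v t) = 2" for t
  proof -
    have "norm (v t) = sqrt ((2 * cos (\<theta> t))\<^sup>2 + (2 * sin (\<theta> t))\<^sup>2)"
      by (simp add: v_def norm_vec_def L2_set_def sum_2)
    also have "(2 * cos (\<theta> t))\<^sup>2 + (2 * sin (\<theta> t))\<^sup>2 = 4 * ((sin (\<theta> t))\<^sup>2 + (cos (\<theta> t))\<^sup>2)"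
      by algebra
    finally show ?thesis by simp
  qed
  have \<gamma>: "smooth_on ?I \<gamma>" unfolding \<gamma>_def[abs_def]
    by (intro smooth_on_vector_2 smooth_on_mult smooth_on_power[OF _ smooth_on_id] a b) auto
  have d\<gamma>: "(\<gamma> has_vector_derivative t *\<^sub>R v t) (at t)" if t: "t \<in> ?I" for t
  proof -
    have "((\<lambda>t. t\<^sup>2 * a t) has_vector_derivative t * (2 * cos (\<theta> t))) (at t)"
      using a(2)[OF t] by (simp add: numeral_2_eq_2)
    moreover have "((\<lambda>t. t ^ 3 * b t) has_vector_derivative t * (2 * sin (\<theta> t))) (at t)"
      using b(2)[OF t] w(2)[OF t] by (simp add: numeral_3_eq_3 power2_eq_square mult_ac)
    ultimately have "(\<gamma> has_vector_derivative (t * (2 * cos (\<theta> t))) *\<^sub>R axis 1 1 + (t * (2 * sin (\<theta> t))) *\<^sub>R axis 2 1) (at t)"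
      unfolding \<gamma>_def[abs_def] vector_2_eq
      by (intro has_vector_derivative_add bounded_linear.has_vector_derivative[OF bounded_linear_scaleR_left])
    then show ?thesis by (simp add: v_def vector_2_eq scaleR_add_right)
  qed
  have s: "arclength \<gamma> t = \<bar>t\<bar> * t * 1" if "t \<in> ?I" for t
    by (rule arclength_eq_signed_square[OF d\<gamma> v _ _ that])
      (auto intro!: smooth_on_const derivative_eq_intros simp: norm_v)
  show thesis
  proof (rule that[OF \<gamma>])
    show "cusp_3_2 \<gamma> 0"
      by (rule cusp_3_2_normal_form[OF \<eta> a(1) _ b(1)])
        (use a(3) b(3) \<eta> f(2) \<open>\<theta> 0 = 0\<close> \<open>w 0 = _\<close> in \<open>auto simp: \<gamma>_def\<close>)
    fix t assume t: "t \<in> ?I"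
    show "half_arclength \<gamma> t = t" using half_arclength_eq[OF s[OF t]] by simp
    assume "t \<noteq> 0"
    have "nth_deriv 1 \<gamma> t = t *\<^sub>R v t" using vector_derivative_at[OF d\<gamma>[OF t]] by (simp add: nth_deriv_def)
    moreover have "v t \<noteq> 0" using norm_v[of t] by auto
    moreover have "bracket (v t) (v' t) = 8 * f t * ((cos (\<theta> t))\<^sup>2 + (sin (\<theta> t))\<^sup>2)"
      by (simp add: bracket_def v_def v'_def algebra_simps power2_eq_square del: sin_cos_squared_add sin_cos_squared_add2 sin_cos_squared_add3)
    ultimately show "nth_deriv 1 \<gamma> t \<noteq> 0 \<and> normalized_curvature \<gamma> t = f t"
      using normalized_curvature_eq[OF d\<gamma> dv s[OF t] _ t \<open>t \<noteq> 0\<close>] \<open>t \<noteq> 0\<close> norm_v[of t] by simp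
  qed
qed

section \<open>The half-arclength parameter and the normalized curvature\<close>

theorem theorem1p1:
  shows
    "(\<forall>(\<epsilon>::real) (\<gamma> :: real \<Rightarrow> real^2).
        \<epsilon> > 0 \<and> smooth_on {-\<epsilon><..<\<epsilon>} \<gamma> \<and> cusp_3_2 \<gamma> 0 \<longrightarrow>
          local_diffeo_at (half_arclength \<gamma>) 0 \<and>
          (\<forall>\<^sub>F t in at 0. nth_deriv 1 \<gamma> t \<noteq> 0) \<and>
          (\<exists>F :: real \<Rightarrow> real. smooth_at F 0 \<and>
             (\<forall>\<^sub>F t in at 0. normalized_curvature \<gamma> t = F t)) \<and>
          (\<exists>G :: real \<Rightarrow> real. smooth_at G 0 \<and>
             (\<forall>\<^sub>F t in at 0. normalized_curvature \<gamma> t = G (half_arclength \<gamma> t))) \<and>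
          (normalized_curvature \<gamma> \<longlongrightarrow> cuspidal_curvature \<gamma> 0 / (2 * sqrt 2)) (at 0)) \<and>
     (\<forall>(\<eta>::real) (f :: real \<Rightarrow> real).
        \<eta> > 0 \<and> smooth_on {-\<eta><..<\<eta>} f \<and> f 0 \<noteq> 0 \<longrightarrow>
          (\<exists>(\<delta>::real) (\<gamma> :: real \<Rightarrow> real^2).
             0 < \<delta> \<and> \<delta> \<le> \<eta> \<and> smooth_on {-\<delta><..<\<delta>} \<gamma> \<and> cusp_3_2 \<gamma> 0 \<and>
             (\<forall>\<tau>\<in>{-\<delta><..<\<delta>}. half_arclength \<gamma> \<tau> = \<tau>) \<and>
             (\<forall>\<tau>\<in>{-\<delta><..<\<delta>} - {0}. nth_deriv 1 \<gamma> \<tau> \<noteq> 0 \<and> normalized_curvature \<gamma> \<tau> = f \<tau>)))"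
  (is "(\<forall>\<epsilon> \<gamma>. ?cusp \<epsilon> \<gamma> \<longrightarrow> ?forward \<gamma>) \<and> (\<forall>\<eta> f. ?datum \<eta> f \<longrightarrow> ?curve \<eta> f)")
proof (intro conjI allI impI)
  fix \<eta> :: real and f :: "real \<Rightarrow> real"
  assume "?datum \<eta> f"
  then obtain \<gamma> where "smooth_on {-\<eta><..<\<eta>} \<gamma>" "cusp_3_2 \<gamma> 0"
    "\<And>t. t \<in> {-\<eta><..<\<eta>} \<Longrightarrow> half_arclength \<gamma> t = t"
    "\<And>t. t \<in> {-\<eta><..<\<eta>} \<Longrightarrow> t \<noteq> 0 \<Longrightarrow> nth_deriv 1 \<gamma> t \<noteq> 0 \<and> normalized_curvature \<gamma> t = f t"
    using cusp_with_prescribed_curvature by metis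
  with \<open>?datum \<eta> f\<close> show "?curve \<eta> f"
    by (intro exI[of _ \<eta>] exI[of _ \<gamma>]) simp
next
  fix \<epsilon> :: real and \<gamma> :: "real \<Rightarrow> real^2"
  assume "?cusp \<epsilon> \<gamma>"
  then obtain e v where e: "0 < e" "smooth_on {-e<..<e} v"
    "\<And>t. t \<in> {-e<..<e} \<Longrightarrow> (\<gamma> has_vector_derivative t *\<^sub>R v t) (at t)"
    "bracket (v 0) (vector_derivative v (at 0)) \<noteq> 0"
    using cusp_3_2_velocity by blast
  then have "v 0 \<noteq> 0" by (auto simp: bracket_def)
  obtain d A F where d: "0 < d" and A: "smooth_on {-d<..<d} A" and F: "smooth_on {-d<..<d} F"
    and Apos: "\<And>t. t \<in> {-d<..<d} \<Longrightarrow> A t > 0"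
    and half: "\<And>t. t \<in> {-d<..<d} \<Longrightarrow> half_arclength \<gamma> t = t * sqrt (A t)"
    and reg: "\<And>t. t \<in> {-d<..<d} \<Longrightarrow> t \<noteq> 0 \<Longrightarrow> nth_deriv 1 \<gamma> t \<noteq> 0"
    and curv: "\<And>t. t \<in> {-d<..<d} \<Longrightarrow> t \<noteq> 0 \<Longrightarrow> normalized_curvature \<gamma> t = F t"
    and F0: "F 0 = cuspidal_curvature \<gamma> 0 / (2 * sqrt 2)"
    by (rule cusp_local_form[OF e(1,2) \<open>v 0 \<noteq> 0\<close> e(3)]) (assumption | rule that)+
  have A0: "A 0 > 0" using Apos d by simp
  have near0: "\<forall>\<^sub>F t in at 0. t \<in> {-c<..<c} \<and> t \<noteq> 0" if "c > 0" for c :: real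
    unfolding eventually_at_filter eventually_nhds_0_interval using that by (intro exI[of _ c]) simp
  have sA: "smooth_on {-d<..<d} (\<lambda>t. sqrt (A t))"
    by (rule smooth_on_sqrt[OF A]) (use Apos in auto)
  let ?h = "\<lambda>t. t * sqrt (A t)"
  have "smooth_on {-d<..<d} ?h" by (rule smooth_on_mult[OF _ smooth_on_id sA]) auto
  moreover have "(?h has_real_derivative sqrt (A 0)) (at 0)"
    using ident_scaleR_derivative[OF sA d] by (simp add: has_real_derivative_iff_has_vector_derivative)
  ultimately obtain c g where c: "0 < c" "c \<le> d" 
    and diff: "diffeomorphism {-c<..<c} (?h ` {-c<..<c}) ?h g"
    using inverse_function_1d[of d ?h "sqrt (A 0)"] d A0 by (metis real_sqrt_gt_zero)
  have half_diff: "diffeomorphism {-c<..<c} (?h ` {-c<..<c}) (half_arclength \<gamma>) g"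
    by (rule diffeomorphism_cong[OF diff]) (use half c(2) in auto)
  note hg = diffeomorphismD[OF half_diff]
  have sub: "{-c<..<c} \<subseteq> {-d<..<d}" using c(2) by auto
  show "local_diffeo_at (half_arclength \<gamma>) 0"
    by (rule local_diffeo_atI[OF half_diff]) (use c in simp)
  show "\<forall>\<^sub>F t in at 0. nth_deriv 1 \<gamma> t \<noteq> 0"
    using near0[OF d] by eventually_elim (use reg in blast)
  have eqF: "\<forall>\<^sub>F t in at 0. normalized_curvature \<gamma> t = F t"
    using near0[OF d] by eventually_elim (use curv in blast)
  then show "\<exists>F :: real \<Rightarrow> real. smooth_at F 0 \<and> (\<forall>\<^sub>F t in at 0. normalized_curvature \<gamma> t = F t)"
    using smooth_atI[OF F] d by (intro exI[of _ F]) simp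
  show "\<exists>G :: real \<Rightarrow> real. smooth_at G 0 \<and> (\<forall>\<^sub>F t in at 0. normalized_curvature \<gamma> t = G (half_arclength \<gamma> t))"
  proof (intro exI conjI)
    have "half_arclength \<gamma> 0 = 0" using half[of 0] d by simp
    then have "0 \<in> ?h ` {-c<..<c}" using hg(5)[of 0] c(1) by simp
    moreover have "smooth_on (?h ` {-c<..<c}) (\<lambda>y. F (g y))"
      by (rule smooth_on_compose[OF F _ hg(2) _ hg(4)]) (use hg(6) sub in auto)
    ultimately show "smooth_at (\<lambda>y. F (g y)) 0" using hg(2) smooth_atI by blast
    show "\<forall>\<^sub>F t in at 0. normalized_curvature \<gamma> t = F (g (half_arclength \<gamma> t))"
      using near0[OF c(1)] eqF by eventually_elim (simp add: hg(7))
  qed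
  show "(normalized_curvature \<gamma> \<longlongrightarrow> cuspidal_curvature \<gamma> 0 / (2 * sqrt 2)) (at 0)"
    unfolding tendsto_cong[OF eqF] F0[symmetric]
    using smooth_on_isCont[OF F, of 0] d by (simp add: isCont_def)
qed

end
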